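(* Let $\mathscr V$ be the category $\mathrm{Conv}$ of convergence spaces. For a locally compact Hausdorff topological space $V$, functional distributions on $V$ in the positive $\mathbb R$-convex context $(\mathscr V,\mathrm{Mat}_{\mathbb R_+}^{\mathrm{aff}},\mathbb R_+)$ are in bijective correspondence with compactly supported Radon probability measures on $V$.
   Context: \emph{Convergence spaces.} A convergence space is a set $X$ with, for each $x\in X$, a set $\mathscr K_x$ of proper filters on $X$ (said to converge to $x$) such that (1) the principal ultrafilter at $x$ converges to $x$; (2) if $\mathscr X,\mathscr Y\in\mathscr K_x$ then $\mathscr X\cap\mathscr Y\in\mathscr K_x$; (3) if $\mathscr Y\supseteq\mathscr X\in\mathscr K_x$ with $\mathscr Y$ a proper filter then $\mathscr Y\in\mathscr K_x$. A map is continuous if it sends filters converging to $x$ to (image) filters converging to $f(x)$. $\mathrm{Conv}$ is the category of convergence spaces and continuous maps; it is complete, cocomplete and cartesian closed, $\underline{\mathscr V}(X,Y)$ being the set of continuous maps with continuous convergence: a filter $\mathscr F$ converges to $g$ iff for every $x\in X$ and every filter $\mathscr X$ converging to $x$, the filter generated by the sets $F(A)=\{f(a)\mid f\in F,a\in A\}$ ($F\in\mathscr F$, $A\in\mathscr X$) converges to $g(x)$. Topological spaces form a full subcategory of $\mathrm{Conv}$. $\mathbb R$ with its usual topology is a ring in $\mathscr V=\mathrm{Conv}$, and $\mathbb R_+\subseteq\mathbb R$ is the subspace (and sub-rig) of non-negative reals. \emph{Theories.} Let $\underline{\mathscr V}$ be $\mathscr V$ as a $\mathscr V$-category. A theory is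 a $\mathscr V$-category $\mathscr T$ whose objects are the natural numbers, with, for each $n$, morphisms $\pi_i:n\to1$ ($1\le i\le n$) exhibiting $n$ as a conical ($\mathscr V$-enriched) $n$-th power of $1$, with $\pi_1=\mathrm{id}$ if $n=1$. A $\mathscr T$-algebra is a $\mathscr V$-functor $A:\mathscr T\to\underline{\mathscr V}$ preserving conical finite powers, with carrier $|A|=A(1)$. $\mathscr T\text{-Alg}$ is the $\mathscr V$-category of $\mathscr T$-algebras, with hom-objects the objects of $\mathscr V$-natural transformations; it has pointwise cotensors $[V,A]$, with carrier $\underline{\mathscr V}(V,|A|)$. \emph{Functional distributions.} The commutant of $\mathscr T$ with respect to a $\mathscr T$-algebra $S$ is the theory $\mathscr T^\perp$ with $\mathscr T^\perp(n,m)=\mathscr T\text{-Alg}(S^n,S^m)$ and composition as in $\mathscr T\text{-Alg}$; $n\mapsto|S|^n$ is a $\mathscr T^\perp$-algebra with carrier $|S|$, again denoted $S$. If $\mathscr T$ is commutative and saturated with respect to $S$ (canonically isomorphic to its double commutant with respect to $S$), then $(\mathscr V,\mathscr T,S)$ is called a finitary functional-analytic context, and functional distributions on $V\in\mathscr V$ are the $\mathscr T^\perp$-algebra homomorphisms $[V,S]\to S$. \emph{Positive $\mathbb R$-convex context.} $\mathrm{Mat}_{\mathbb R_+}^{\mathrm{aff}}$ is the theory whose hom-object $\mathrm{Mat}_{\mathbb R_+}^{\mathrm{aff}}(n,m)$ is the subspace of $\mathbb R_+^{m\times n}$ consisting of the $m\times n$ matrices over $\mathbb R_+$ with each row summing to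 $1$, with composition given by matrix multiplication and designated projections the standard basis row vectors. $\mathbb R_+$ is the carrier of an algebra of this theory, in which a matrix $a$ acts as $x\mapsto(\sum_ia_{ji}x_i)_j:\mathbb R_+^n\to\mathbb R_+^m$. The finitary functional-analytic context $(\mathscr V,\mathrm{Mat}_{\mathbb R_+}^{\mathrm{aff}},\mathbb R_+)$ is the positive $\mathbb R$-convex context in $\mathscr V$. *)

theory Defs
  imports "HOL-Analysis.Analysis" "HOL-Probability.Probability_Measure"
begin

section \<open>Convergence spaces\<close>

text \<open>
  A space is a carrier set inside a type. A filter on the carrier is encoded as a filter \<open>F\<close> on the
  type with \<open>F \<le> principal\<close> of the carrier. The order on \<^typ>\<open>'a filter\<close> is reverse inclusion of
  the collections of sets: \<open>G \<le> F\<close> says that \<open>G\<close> is finer than \<open>F\<close>, \<open>sup F G\<close> is the intersection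
  of the two collections, and a filter is proper iff it is not \<open>bot\<close>.
\<close>

record 'a cspace =
  points :: "'a set"
  converges :: "'a filter \<Rightarrow> 'a \<Rightarrow> bool"

definition filter_on :: "'a set \<Rightarrow> 'a filter \<Rightarrow> bool" where
  "filter_on A F \<longleftrightarrow> F \<noteq> bot \<and> F \<le> principal A"

definition convergence_space :: "'a cspace \<Rightarrow> bool" where
  "convergence_space X \<longleftrightarrow>
     (\<forall>F x. converges X F x \<longrightarrow> x \<in> points X \<and> filter_on (points X) F) \<and>
     (\<forall>x\<in>points X. converges X (principal {x}) x) \<and>
     (\<forall>F G x. converges X F x \<and> converges X G x \<longrightarrow> converges X (sup F G) x) \<and>
     (\<forall>F G x. converges X F x \<and> G \<le> F \<and> G \<noteq> bot \<longrightarrow> converges X G x)"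

text \<open>Maps are extensional, so that equality of maps is equality of functions on the carrier.\<close>

definition cmaps :: "'a cspace \<Rightarrow> 'b cspace \<Rightarrow> ('a \<Rightarrow> 'b) set" where
  "cmaps X Y = {f \<in> points X \<rightarrow>\<^sub>E points Y.
     \<forall>F x. converges X F x \<longrightarrow> converges Y (filtermap f F) (f x)}"

definition ciso :: "'a cspace \<Rightarrow> 'b cspace \<Rightarrow> ('a \<Rightarrow> 'b) \<Rightarrow> bool" where
  "ciso X Y f \<longleftrightarrow> f \<in> cmaps X Y \<and>
     (\<exists>g\<in>cmaps Y X. (\<forall>x\<in>points X. g (f x) = x) \<and> (\<forall>y\<in>points Y. f (g y) = y))"

text \<open>The internal hom. The filter generated by the sets \<open>{f a | f \<in> F, a \<in> A}\<close> is the image of the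
  product filter under evaluation.\<close>

definition chom :: "'a cspace \<Rightarrow> 'b cspace \<Rightarrow> ('a \<Rightarrow> 'b) cspace" where
  "chom X Y = \<lparr> points = cmaps X Y,
     converges = (\<lambda>F g. g \<in> cmaps X Y \<and> filter_on (cmaps X Y) F \<and>
       (\<forall>G x. converges X G x \<longrightarrow>
          converges Y (filtermap (\<lambda>(f, a). f a) (F \<times>\<^sub>F G)) (g x))) \<rparr>"

definition csub :: "'a cspace \<Rightarrow> 'a set \<Rightarrow> 'a cspace" where
  "csub X A = \<lparr> points = points X \<inter> A,
     converges = (\<lambda>F x. x \<in> A \<and> F \<le> principal A \<and> converges X F x) \<rparr>"

definition cprod :: "'i set \<Rightarrow> ('i \<Rightarrow> 'a cspace) \<Rightarrow> ('i \<Rightarrow> 'a) cspace" where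
  "cprod I X = \<lparr> points = (\<Pi>\<^sub>E i\<in>I. points (X i)),
     converges = (\<lambda>F x. x \<in> (\<Pi>\<^sub>E i\<in>I. points (X i)) \<and> filter_on (\<Pi>\<^sub>E i\<in>I. points (X i)) F \<and>
       (\<forall>i\<in>I. converges (X i) (filtermap (\<lambda>y. y i) F) (x i))) \<rparr>"

abbreviation cpower :: "'a cspace \<Rightarrow> nat \<Rightarrow> (nat \<Rightarrow> 'a) cspace" where
  "cpower X n \<equiv> cprod {..<n} (\<lambda>_. X)"

definition cpair :: "'a cspace \<Rightarrow> 'b cspace \<Rightarrow> ('a \<times> 'b) cspace" where
  "cpair X Y = \<lparr> points = points X \<times> points Y,
     converges = (\<lambda>F z. filter_on (points X \<times> points Y) F \<and>
       converges X (filtermap fst F) (fst z) \<and> converges Y (filtermap snd F) (snd z)) \<rparr>"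

definition ctop :: "'a topology \<Rightarrow> 'a cspace" where
  "ctop T = \<lparr> points = topspace T,
     converges = (\<lambda>F x. x \<in> topspace T \<and> filter_on (topspace T) F \<and> F \<le> nhdsin T x) \<rparr>"

definition cRplus :: "real cspace" where
  "cRplus = csub (ctop euclideanreal) {0..}"


section \<open>Theories and their algebras\<close>

text \<open>
  Since a structure of \<open>Conv\<close>-category is a property of a category whose hom-sets carry convergence
  structures (composition has to be continuous), and likewise for \<open>Conv\<close>-functors, while
  \<open>Conv\<close>-natural transformations are just natural transformations, everything is given by ordinary
  categorical data. The predicates \<open>is_theory\<close> and \<open>is_algebra\<close> state what is required of the data;
  the constructions below make sense for arbitrary data. The composite of \<open>f : l \<rightarrow> m\<close> and \<open>g : m \<rightarrow> n\<close> is \<open>comp T l m n g f\<close>, and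
  projections are indexed from 0.
\<close>

record 'h cthy =
  hom :: "nat \<Rightarrow> nat \<Rightarrow> 'h cspace"
  comp :: "nat \<Rightarrow> nat \<Rightarrow> nat \<Rightarrow> 'h \<Rightarrow> 'h \<Rightarrow> 'h"
  ident :: "nat \<Rightarrow> 'h"
  proj :: "nat \<Rightarrow> nat \<Rightarrow> 'h"

definition is_category :: "'h cthy \<Rightarrow> bool" where
  "is_category T \<longleftrightarrow>
     (\<forall>n m. convergence_space (hom T n m)) \<and>
     (\<forall>l m n. (\<lambda>(g, f)\<in>points (hom T m n) \<times> points (hom T l m). comp T l m n g f)
        \<in> cmaps (cpair (hom T m n) (hom T l m)) (hom T l n)) \<and>
     (\<forall>n. ident T n \<in> points (hom T n n)) \<and>
     (\<forall>n m. \<forall>f\<in>points (hom T n m).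
        comp T n n m f (ident T n) = f \<and> comp T n m m (ident T m) f = f) \<and>
     (\<forall>k l m n. \<forall>f\<in>points (hom T k l). \<forall>g\<in>points (hom T l m). \<forall>h\<in>points (hom T m n).
        comp T k l n (comp T l m n h g) f = comp T k m n h (comp T k l m g f))"

definition is_power :: "'h cthy \<Rightarrow> nat \<Rightarrow> nat \<Rightarrow> nat \<Rightarrow> (nat \<Rightarrow> 'h) \<Rightarrow> bool" where
  "is_power T p m n q \<longleftrightarrow> (\<forall>i<n. q i \<in> points (hom T p m)) \<and>
     (\<forall>l. ciso (hom T l p) (cpower (hom T l m) n)
        (\<lambda>f\<in>points (hom T l p). \<lambda>i\<in>{..<n}. comp T l p m (q i) f))"

definition is_theory :: "'h cthy \<Rightarrow> bool" where
  "is_theory T \<longleftrightarrow> is_category T \<and> (\<forall>n. is_power T n 1 n (proj T n)) \<and> proj T 1 0 = ident T 1"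

record ('h, 'a) calg =
  obj :: "nat \<Rightarrow> 'a cspace"
  act :: "nat \<Rightarrow> nat \<Rightarrow> 'h \<Rightarrow> 'a \<Rightarrow> 'a"

abbreviation carrier_space :: "('h, 'a) calg \<Rightarrow> 'a cspace" where
  "carrier_space A \<equiv> obj A 1"

definition is_functor :: "'h cthy \<Rightarrow> ('h, 'a) calg \<Rightarrow> bool" where
  "is_functor T A \<longleftrightarrow>
     (\<forall>n. convergence_space (obj A n)) \<and>
     (\<forall>n m. (\<lambda>h\<in>points (hom T n m). act A n m h)
        \<in> cmaps (hom T n m) (chom (obj A n) (obj A m))) \<and>
     (\<forall>n. \<forall>x\<in>points (obj A n). act A n n (ident T n) x = x) \<and>
     (\<forall>l m n. \<forall>f\<in>points (hom T l m). \<forall>g\<in>points (hom T m n). \<forall>x\<in>points (obj A l).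
        act A l n (comp T l m n g f) x = act A m n g (act A l m f x))"

definition is_algebra :: "'h cthy \<Rightarrow> ('h, 'a) calg \<Rightarrow> bool" where
  "is_algebra T A \<longleftrightarrow> is_functor T A \<and>
     (\<forall>p m n q. is_power T p m n q \<longrightarrow>
        ciso (obj A p) (cpower (obj A m) n)
          (\<lambda>x\<in>points (obj A p). \<lambda>i\<in>{..<n}. act A p m (q i) x))"

text \<open>The hom-object of \<open>T\<close>-Alg: the end of the internal homs, as a subspace of their product.\<close>

definition alg_hom :: "'h cthy \<Rightarrow> ('h, 'a) calg \<Rightarrow> ('h, 'b) calg \<Rightarrow> (nat \<Rightarrow> 'a \<Rightarrow> 'b) cspace" where
  "alg_hom T A B = csub (cprod UNIV (\<lambda>n. chom (obj A n) (obj B n)))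
     {\<alpha>. \<forall>n m. \<forall>h\<in>points (hom T n m). \<forall>x\<in>points (obj A n).
        act B n m h (\<alpha> n x) = \<alpha> m (act A n m h x)}"

definition alg_power :: "('h, 'a) calg \<Rightarrow> nat \<Rightarrow> ('h, nat \<Rightarrow> 'a) calg" where
  "alg_power A n = \<lparr> obj = (\<lambda>k. cpower (obj A k) n),
     act = (\<lambda>k l h. \<lambda>x\<in>points (cpower (obj A k) n). \<lambda>i\<in>{..<n}. act A k l h (x i)) \<rparr>"

definition alg_cotensor :: "'v cspace \<Rightarrow> ('h, 'a) calg \<Rightarrow> ('h, 'v \<Rightarrow> 'a) calg" where
  "alg_cotensor V A = \<lparr> obj = (\<lambda>k. chom V (obj A k)),
     act = (\<lambda>k l h. \<lambda>f\<in>cmaps V (obj A k). \<lambda>v\<in>points V. act A k l h (f v)) \<rparr>"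


section \<open>Commutants and functional distributions\<close>

text \<open>
  The first power of \<open>S\<close> consists of families indexed by \<open>{..<1}\<close>; hence, for an element \<open>x\<close> of the
  \<open>n\<close>-th power, \<open>\<lambda>j\<in>{..<1}. x i\<close> is its \<open>i\<close>-th component, seen in the first power.
\<close>

definition commutant ::
  "'h cthy \<Rightarrow> ('h, 'a) calg \<Rightarrow> (nat \<Rightarrow> (nat \<Rightarrow> 'a) \<Rightarrow> (nat \<Rightarrow> 'a)) cthy" where
  "commutant T S = \<lparr>
     hom = (\<lambda>n m. alg_hom T (alg_power S n) (alg_power S m)),
     comp = (\<lambda>l m n \<beta> \<alpha> k. compose (points (cpower (obj S k) l)) (\<beta> k) (\<alpha> k)),
     ident = (\<lambda>n k. \<lambda>x\<in>points (cpower (obj S k) n). x),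
     proj = (\<lambda>n i k. \<lambda>x\<in>points (cpower (obj S k) n). \<lambda>j\<in>{..<1}. x i) \<rparr>"

text \<open>\<open>S\<close> as an algebra of its commutant. Its carrier is the first power of \<open>carrier_space S\<close>, which is
  identified with \<open>carrier_space S\<close>.\<close>

definition commutant_alg ::
  "('h, 'a) calg \<Rightarrow> (nat \<Rightarrow> (nat \<Rightarrow> 'a) \<Rightarrow> (nat \<Rightarrow> 'a), nat \<Rightarrow> 'a) calg" where
  "commutant_alg S = \<lparr> obj = (\<lambda>n. cpower (carrier_space S) n), act = (\<lambda>n m \<alpha>. \<alpha> 1) \<rparr>"

definition functional_distributions ::
  "'h cthy \<Rightarrow> ('h, 'a) calg \<Rightarrow> 'v cspace \<Rightarrow> (nat \<Rightarrow> ('v \<Rightarrow> nat \<Rightarrow> 'a) \<Rightarrow> nat \<Rightarrow> 'a) set" where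
  "functional_distributions T S V =
     points (alg_hom (commutant T S) (alg_cotensor V (commutant_alg S)) (commutant_alg S))"


section \<open>The positive \<open>\<real>\<close>-convex context\<close>

definition mat_aff :: "(nat \<times> nat \<Rightarrow> real) cthy" where
  "mat_aff = \<lparr>
     hom = (\<lambda>n m. csub (cprod ({..<m} \<times> {..<n}) (\<lambda>_. cRplus)) {a. \<forall>j<m. (\<Sum>i<n. a (j, i)) = 1}),
     comp = (\<lambda>l m n b a. \<lambda>(j, i)\<in>{..<n} \<times> {..<l}. \<Sum>k<m. b (j, k) * a (k, i)),
     ident = (\<lambda>n. \<lambda>(j, i)\<in>{..<n} \<times> {..<n}. if j = i then 1 else 0),
     proj = (\<lambda>n k. \<lambda>(j, i)\<in>{..<1} \<times> {..<n}. if i = k then 1 else 0) \<rparr>"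

text \<open>The carrier is \<open>\<real>\<^sub>+\<^sup>1\<close>, the space of families indexed by \<open>{..<1}\<close>.\<close>

definition Rplus_alg :: "(nat \<times> nat \<Rightarrow> real, nat \<Rightarrow> real) calg" where
  "Rplus_alg = \<lparr> obj = (\<lambda>n. cpower cRplus n),
     act = (\<lambda>n m a. \<lambda>x\<in>points (cpower cRplus n). \<lambda>j\<in>{..<m}. \<Sum>i<n. a (j, i) * x i) \<rparr>"


section \<open>Radon measures\<close>

text \<open>A Radon measure is a locally finite Borel measure that is inner regular with respect to compact
  sets on all Borel sets; for finite measures on a locally compact Hausdorff space this agrees with the
  convention requiring inner regularity on open sets and outer regularity on Borel sets.\<close>

definition radon_measure :: "'v topology \<Rightarrow> 'v measure \<Rightarrow> bool" where
  "radon_measure X M \<longleftrightarrow>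
     space M = topspace X \<and> sets M = sigma_sets (topspace X) {U. openin X U} \<and>
     (\<forall>x\<in>topspace X. \<exists>U. openin X U \<and> x \<in> U \<and> emeasure M U < \<infinity>) \<and>
     (\<forall>B\<in>sets M. emeasure M B = (SUP K\<in>{K. compactin X K \<and> K \<subseteq> B}. emeasure M K))"

definition measure_support :: "'v topology \<Rightarrow> 'v measure \<Rightarrow> 'v set" where
  "measure_support X M = {x \<in> topspace X. \<forall>U. openin X U \<and> x \<in> U \<longrightarrow> emeasure M U > 0}"

definition compact_radon_probabilities :: "'v topology \<Rightarrow> 'v measure set" where
  "compact_radon_probabilities X =
     {M. prob_space M \<and> radon_measure X M \<and> compactin X (measure_support X M)}"

text \<open>Integration of continuous functions against \<open>M\<close>. At \<open>n\<close>, the argument is a continuous map into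
  \<open>|S|\<^sup>n = (\<real>\<^sub>+\<^sup>1)\<^sup>n\<close>, which is integrated componentwise.\<close>

definition integration_distribution ::
  "'v topology \<Rightarrow> 'v measure \<Rightarrow> nat \<Rightarrow> ('v \<Rightarrow> nat \<Rightarrow> nat \<Rightarrow> real) \<Rightarrow> nat \<Rightarrow> nat \<Rightarrow> real" where
  "integration_distribution X M =
     (\<lambda>n. \<lambda>f\<in>cmaps (ctop X) (cpower (carrier_space Rplus_alg) n).
        \<lambda>i\<in>{..<n}. \<lambda>j\<in>{..<1}. \<integral>v. f v i j \<partial>M)"

end

theory Submission
  imports Defs
begin

text \<open>
  The commutant of \<^const>\<open>mat_aff\<close> acts on \<open>\<real>\<^sub>+\<close> by maps \<open>\<real>\<^sub>+\<^sup>n \<rightarrow> \<real>\<^sub>+\<^sup>m\<close> that preserve convex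
  combinations, that is, by affine maps; conversely, every affine form with non-negative coefficients
  occurs (\<open>affine_maps_affine\<close>, \<open>affine_op_in\<close>). Naturality with respect to the commutant
  therefore makes a functional distribution the same thing as a map \<open>\<mu> : C(V, \<real>\<^sub>+) \<rightarrow> \<real>\<^sub>+\<close> that is
  additive, homogeneous for non-negative scalars and maps \<open>1\<close> to \<open>1\<close>, and that is continuous for
  continuous convergence: all its components are determined by the one at \<open>1\<close>.

  Continuity is used only once, to see that \<open>\<mu>\<close> is compactly supported. Local compactness makes the
  filter generated by the sets \<open>{f. f = 0 on C}\<close>, with \<open>C\<close> compact, converge continuously to \<open>0\<close>. So
  \<open>\<mu> < 1\<close> on one of these sets, which is closed under multiplication by positive scalars, and hence
  \<open>\<mu> = 0\<close> on it (\<open>compactly_supported\<close>). From then on \<open>\<mu>\<close> is just a positive functional that only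
  sees the values on a compact set \<open>K\<close>, and a Riesz representation theorem applies
  (\<open>L_eq_integral\<close>): the mass of an open set \<open>U\<close> is the supremum of \<open>\<mu> u\<close> over the continuous
  \<open>u\<close> between \<open>0\<close> and the indicator of \<open>U\<close>, and Caratheodory's construction extends it to all Borel
  sets. The set \<open>K\<close> supplies the compactness that
  is elsewhere obtained from compactly supported \<open>u\<close>.

  Conversely, integration against a compactly supported Radon probability commutes with affine maps.
  It is continuous since continuous convergence is uniform on the support, by compactness
  (\<open>integral_tendsto\<close>). A Radon probability is determined by its integrals because these determine
  the mass of compact sets, by Urysohn's lemma (\<open>compact_radon_probability_eqI\<close>).
\<close>

section \<open>Non-negative continuous functions and bump functions\<close>

definition nonneg_cont :: "'v topology \<Rightarrow> ('v \<Rightarrow> real) set" where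
  "nonneg_cont X = {u. continuous_map X euclideanreal u \<and> (\<forall>x\<in>topspace X. 0 \<le> u x)}"

lemma nonneg_cont_intros:
  shows nonneg_cont_const: "0 \<le> c \<Longrightarrow> (\<lambda>_. c) \<in> nonneg_cont X"
    and nonneg_cont_add: "u \<in> nonneg_cont X \<Longrightarrow> w \<in> nonneg_cont X \<Longrightarrow> (\<lambda>x. u x + w x) \<in> nonneg_cont X"
    and nonneg_cont_scale: "0 \<le> c \<Longrightarrow> u \<in> nonneg_cont X \<Longrightarrow> (\<lambda>x. c * u x) \<in> nonneg_cont X"
    and nonneg_cont_max: "u \<in> nonneg_cont X \<Longrightarrow> w \<in> nonneg_cont X \<Longrightarrow> (\<lambda>x. max (u x) (w x)) \<in> nonneg_cont X"
    and nonneg_cont_min: "u \<in> nonneg_cont X \<Longrightarrow> w \<in> nonneg_cont X \<Longrightarrow> (\<lambda>x. min (u x) (w x)) \<in> nonneg_cont X"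
    and nonneg_cont_diff: "u \<in> nonneg_cont X \<Longrightarrow> w \<in> nonneg_cont X \<Longrightarrow>
        (\<And>x. x \<in> topspace X \<Longrightarrow> w x \<le> u x) \<Longrightarrow> (\<lambda>x. u x - w x) \<in> nonneg_cont X"
    and nonneg_cont_truncate: "u \<in> nonneg_cont X \<Longrightarrow> (\<lambda>x. max 0 (u x - c)) \<in> nonneg_cont X"
  by (auto simp: nonneg_cont_def intro!: continuous_map_real_max continuous_map_real_min
      continuous_map_add continuous_map_diff continuous_map_real_mult)

lemma nonneg_cont_sum:
  "(\<And>i. i \<in> I \<Longrightarrow> u i \<in> nonneg_cont X) \<Longrightarrow> (\<lambda>x. \<Sum>i\<in>I. u i x) \<in> nonneg_cont X"
  by (induction I rule: infinite_finite_induct) (auto intro: nonneg_cont_intros)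

lemma nonneg_contD:
  assumes "u \<in> nonneg_cont X"
  shows "continuous_map X euclideanreal u" "x \<in> topspace X \<Longrightarrow> 0 \<le> u x"
  using assms by (auto simp: nonneg_cont_def)

lemma openin_less_nonneg_cont:
  assumes "u \<in> nonneg_cont X"
  shows "openin X {x \<in> topspace X. c < u x}"
  using openin_continuous_map_preimage[OF nonneg_contD(1)[OF assms], of "{c<..}"] by simp

lemma closedin_le_nonneg_cont:
  assumes "u \<in> nonneg_cont X"
  shows "closedin X {x \<in> topspace X. c \<le> u x}"
  using closedin_continuous_map_preimage[OF nonneg_contD(1)[OF assms], of "{c..}"] by simp

definition bumps :: "'v topology \<Rightarrow> 'v set \<Rightarrow> ('v \<Rightarrow> real) set" where
  "bumps X U = {u \<in> nonneg_cont X. (\<forall>x\<in>topspace X. u x \<le> 1) \<and> (\<forall>x\<in>topspace X - U. u x = 0)}"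

lemma bumpsD:
  assumes "u \<in> bumps X U"
  shows "u \<in> nonneg_cont X" "x \<in> topspace X \<Longrightarrow> 0 \<le> u x" "x \<in> topspace X \<Longrightarrow> u x \<le> 1"
    "x \<in> topspace X \<Longrightarrow> x \<notin> U \<Longrightarrow> u x = 0"
  using assms by (auto simp: bumps_def nonneg_cont_def)

text \<open>
  Urysohn's lemma; it applies because locally compact Hausdorff spaces are completely regular.
\<close>

lemma bump_exists:
  assumes "locally_compact_space X" "Hausdorff_space X" "compactin X C" "openin X U" "C \<subseteq> U"
  obtains u where "u \<in> bumps X U" "\<And>x. x \<in> C \<Longrightarrow> u x = 1"
proof -
  have "completely_regular_space X"
    using assms locally_compact_regular_imp_completely_regular_space by blast
  moreover have "disjnt C (topspace X - U)"
    using \<open>C \<subseteq> U\<close> by (auto simp: disjnt_def)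
  moreover have "closedin X (topspace X - U)"
    using \<open>openin X U\<close> by blast
  ultimately obtain u where u: "continuous_map X (subtopology euclideanreal {0..1}) u"
      "u ` (topspace X - U) \<subseteq> {0}" "u ` C \<subseteq> {1}"
    using Urysohn_completely_regular_compact_closed[of 0 1 X C "topspace X - U"] assms(3) by auto
  from u(1) have "continuous_map X euclideanreal u" "u ` topspace X \<subseteq> {0..1}"
    by (auto simp: continuous_map_in_subtopology image_subset_iff_funcset)
  with u that[of u] show ?thesis
    by (auto simp: bumps_def nonneg_cont_def image_subset_iff)
qed

lemma borel_measurable_continuous_map:
  assumes "space M = topspace X" "sets M = sigma_sets (topspace X) {U. openin X U}"
    and u: "continuous_map X euclideanreal u"
  shows "u \<in> borel_measurable M"
proof (rule borel_measurableI)
  fix S :: "real set" assume "open S"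
  then have "openin X {x \<in> topspace X. u x \<in> S}"
    using openin_continuous_map_preimage[OF u, of S] by simp
  then have "{x \<in> topspace X. u x \<in> S} \<in> sets M"
    unfolding assms(2) by (intro sigma_sets.Basic CollectI)
  also have "{x \<in> topspace X. u x \<in> S} = u -` S \<inter> space M"
    by (auto simp: assms(1))
  finally show "u -` S \<inter> space M \<in> sets M" .
qed

text \<open>
  The complement of the support is the union of the open null sets.
\<close>

lemma closedin_measure_support: "closedin X (measure_support X M)"
proof -
  have "topspace X - measure_support X M = \<Union>{U. openin X U \<and> emeasure M U = 0}"
    using openin_subset by (fastforce simp: measure_support_def zero_less_iff_neq_zero)
  then have "openin X (topspace X - measure_support X M)"
    by (metis (no_types, lifting) mem_Collect_eq openin_Union)
  moreover have "measure_support X M \<subseteq> topspace X"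
    by (auto simp: measure_support_def)
  ultimately show ?thesis by (simp add: closedin_def)
qed

section \<open>A Riesz representation theorem for compactly supported means\<close>

text \<open>
  The functional is defined on all functions, but constrained only on continuous ones with
  non-negative values. The last axiom says that it is concentrated on the compact set \<open>K\<close>.
\<close>

locale compactly_supported_mean =
  fixes X :: "'v topology" and K :: "'v set" and L :: "('v \<Rightarrow> real) \<Rightarrow> real"
  assumes locally_compact: "locally_compact_space X"
    and Hausdorff: "Hausdorff_space X"
    and compact: "compactin X K"
    and L_nonneg: "\<And>u. u \<in> nonneg_cont X \<Longrightarrow> 0 \<le> L u"
    and L_add: "\<And>u w. u \<in> nonneg_cont X \<Longrightarrow> w \<in> nonneg_cont X \<Longrightarrow> L (\<lambda>x. u x + w x) = L u + L w"
    and L_scale: "\<And>c u. 0 \<le> c \<Longrightarrow> u \<in> nonneg_cont X \<Longrightarrow> L (\<lambda>x. c * u x) = c * L u"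
    and L_one: "L (\<lambda>_. 1) = 1"
    and L_vanish: "\<And>u. u \<in> nonneg_cont X \<Longrightarrow> (\<And>x. x \<in> K \<Longrightarrow> u x = 0) \<Longrightarrow> L u = 0"

context compactly_supported_mean
begin

lemma K_subset: "K \<subseteq> topspace X"
  using compact by (rule compactin_subset_topspace)

text \<open>
  The functional is positive and cannot see anything outside \<open>K\<close>, so \<open>w\<close> may be replaced by
  \<open>max u w\<close>, which agrees with \<open>w\<close> on \<open>K\<close> and exceeds \<open>u\<close> everywhere.
\<close>

lemma L_mono:
  assumes u: "u \<in> nonneg_cont X" and w: "w \<in> nonneg_cont X" and le: "\<And>x. x \<in> K \<Longrightarrow> u x \<le> w x"
  shows "L u \<le> L w"
proof -
  let ?m = "\<lambda>x. max (u x) (w x)"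
  have m: "?m \<in> nonneg_cont X"
    using u w by (rule nonneg_cont_max)
  have mu: "(\<lambda>x. ?m x - u x) \<in> nonneg_cont X" and mw: "(\<lambda>x. ?m x - w x) \<in> nonneg_cont X"
    by (auto intro: nonneg_cont_diff m u w)
  have "L ?m = L u + L (\<lambda>x. ?m x - u x)"
    using L_add[OF u mu] by simp
  moreover have "L ?m = L w + L (\<lambda>x. ?m x - w x)"
    using L_add[OF w mw] by simp
  moreover have "L (\<lambda>x. ?m x - w x) = 0"
    by (rule L_vanish[OF mw]) (simp add: le max_absorb2)
  ultimately show ?thesis
    using L_nonneg[OF mu] by linarith
qed

lemma L_const: "0 \<le> c \<Longrightarrow> L (\<lambda>_. c) = c"
  using L_scale[of c "\<lambda>_. 1"] L_one by (simp add: nonneg_cont_const)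

lemma L_sum:
  assumes "finite I" "\<And>i. i \<in> I \<Longrightarrow> u i \<in> nonneg_cont X"
  shows "L (\<lambda>x. \<Sum>i\<in>I. u i x) = (\<Sum>i\<in>I. L (u i))"
  using assms
  by (induction I rule: finite_induct) (simp_all add: L_const L_add nonneg_cont_sum)

text \<open>
  The future measure of an open set.
\<close>

definition open_mass :: "'v set \<Rightarrow> ennreal" where
  "open_mass U = (SUP u\<in>bumps X U. ennreal (L u))"

lemma open_mass_mono: "U \<subseteq> W \<Longrightarrow> open_mass U \<le> open_mass W"
  unfolding open_mass_def by (rule SUP_subset_mono) (auto simp: bumps_def)

lemma L_le_open_mass: "u \<in> bumps X U \<Longrightarrow> ennreal (L u) \<le> open_mass U"
  unfolding open_mass_def by (rule SUP_upper)

lemma zero_bump: "(\<lambda>_. 0) \<in> bumps X U"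
  by (simp add: bumps_def nonneg_cont_const)

lemma open_mass_eq_0:
  assumes "U \<inter> K = {}"
  shows "open_mass U = 0"
proof -
  have "L u = 0" if "u \<in> bumps X U" for u
    using that assms K_subset by (intro L_vanish) (auto simp: bumps_def)
  then show ?thesis
    unfolding open_mass_def using zero_bump[of U]
    by (intro antisym SUP_least) auto
qed

lemma compactin_level:
  assumes "u \<in> nonneg_cont X"
  shows "compactin X (K \<inter> {x \<in> topspace X. c \<le> u x})"
  by (simp add: compact_Int_closedin[OF compact closedin_le_nonneg_cont[OF assms]])

text \<open>
  Up to \<open>e\<close>, a bump \<open>u\<close> of \<open>U \<union> W\<close> only matters on the compact set \<open>C\<close> of points of \<open>K\<close> where
  \<open>e \<le> u\<close>. There it is dominated by the sum of a bump of \<open>U\<close> and a bump of \<open>W\<close>, which may well exceed \<open>1\<close>.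
\<close>

lemma open_mass_Un:
  assumes U: "openin X U" and W: "openin X W"
  shows "open_mass (U \<union> W) \<le> open_mass U + open_mass W"
  unfolding open_mass_def[of "U \<union> W"]
proof (rule SUP_least)
  fix u assume u: "u \<in> bumps X (U \<union> W)"
  have u': "u \<in> nonneg_cont X" by (rule bumpsD[OF u])
  show "ennreal (L u) \<le> open_mass U + open_mass W"
  proof (rule ennreal_le_epsilon)
    fix e :: real assume "0 < e"
    define C where "C = K \<inter> {x \<in> topspace X. e \<le> u x}"
    have "compactin X C"
      unfolding C_def using u' by (rule compactin_level)
    have CUW: "C \<subseteq> U \<union> W"
      using u \<open>0 < e\<close> K_subset by (force simp: C_def bumps_def)
    have "compactin X (C - U)"
      using closed_compactin[OF \<open>compactin X C\<close>, of "C - U"]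
        compactin_imp_closedin[OF Hausdorff \<open>compactin X C\<close>] U by (auto intro: closedin_diff)
    then obtain g where g: "g \<in> bumps X W" "\<And>x. x \<in> C - U \<Longrightarrow> g x = 1"
      using bump_exists[OF locally_compact Hausdorff _ W] CUW by (metis Diff_subset_conv)
    \<comment> \<open>The bump \<open>g\<close> handles \<open>C - U\<close> and its neighbourhood where \<open>g > 1/2\<close>; what remains of \<open>C\<close> is
      compact and inside \<open>U\<close>. Doubling \<open>g\<close> makes it at least \<open>1\<close> on that neighbourhood.\<close>
    define D where "D = C - {x \<in> topspace X. 1/2 < g x}"
    have "compactin X D"
      using closed_compactin[OF \<open>compactin X C\<close>, of D]
        compactin_imp_closedin[OF Hausdorff \<open>compactin X C\<close>]
        openin_less_nonneg_cont[OF bumpsD(1)[OF g(1)], of "1/2"]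
      by (auto intro: closedin_diff simp: D_def)
    moreover have "D \<subseteq> U"
      using g(2) compactin_subset_topspace[OF \<open>compactin X C\<close>] by (force simp: D_def)
    ultimately obtain h where h: "h \<in> bumps X U" "\<And>x. x \<in> D \<Longrightarrow> h x = 1"
      using bump_exists[OF locally_compact Hausdorff _ U] by metis
    define g' where "g' = (\<lambda>x. min 1 (2 * g x))"
    have g': "g' \<in> bumps X W"
      using g(1) unfolding g'_def bumps_def
      by (auto intro!: nonneg_cont_min nonneg_cont_const nonneg_cont_scale)
    have le: "u x \<le> e + (h x + g' x)" if "x \<in> K" for x
    proof -
      have xK: "x \<in> K" and x: "x \<in> topspace X" using that K_subset by auto
      note b = bumpsD(2,3)[OF h(1) x] bumpsD(2,3)[OF g' x] bumpsD(3)[OF u x]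
      consider "u x < e" | "x \<in> D" | "1/2 < g x"
        using x xK by (cases "u x < e"; cases "1/2 < g x") (auto simp: D_def C_def)
      then show ?thesis
        by cases (use b \<open>0 < e\<close> h(2) in \<open>auto simp: g'_def\<close>)
    qed
    note n = bumpsD(1)[OF h(1)] bumpsD(1)[OF g']
    have "L u \<le> L (\<lambda>x. e + (h x + g' x))"
      using le u' n \<open>0 < e\<close> by (intro L_mono nonneg_cont_add nonneg_cont_const) auto
    also have "\<dots> = e + (L h + L g')"
      using n \<open>0 < e\<close> by (simp add: L_add L_const nonneg_cont_add nonneg_cont_const)
    finally have "ennreal (L u) \<le> ennreal (L h) + ennreal (L g') + ennreal e"
      using n \<open>0 < e\<close> by (simp add: L_nonneg ennreal_leI ennreal_plus[symmetric] add.commute del: ennreal_plus)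
    also have "\<dots> \<le> open_mass U + open_mass W + ennreal e"
      using h(1) g' by (intro add_mono L_le_open_mass) auto
    finally show "ennreal (L u) \<le> open_mass U + open_mass W + ennreal e" .
  qed
qed

lemma open_mass_finite_UN:
  fixes n :: nat
  assumes "\<And>i. openin X (U i)"
  shows "open_mass (\<Union>i<n. U i) \<le> (\<Sum>i<n. open_mass (U i))"
proof (induction n)
  case 0
  show ?case by (simp add: open_mass_eq_0)
next
  case (Suc n)
  have "open_mass (\<Union>i<Suc n. U i) = open_mass ((\<Union>i<n. U i) \<union> U n)"
    by (simp add: lessThan_Suc Un_commute)
  also have "\<dots> \<le> open_mass (\<Union>i<n. U i) + open_mass (U n)"
    using assms by (intro open_mass_Un) auto
  finally show ?case
    using Suc by (simp add: add_right_mono order_trans)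
qed

text \<open>
  Compactness of the part of \<open>K\<close> where \<open>e \<le> u\<close> reduces countable to finite unions.
\<close>

lemma open_mass_UN:
  fixes U :: "nat \<Rightarrow> 'v set"
  assumes U: "\<And>i. openin X (U i)"
  shows "open_mass (\<Union>i. U i) \<le> (\<Sum>i. open_mass (U i))"
  unfolding open_mass_def[of "\<Union>i. U i"]
proof (rule SUP_least)
  fix u assume u: "u \<in> bumps X (\<Union>i. U i)"
  have u': "u \<in> nonneg_cont X" by (rule bumpsD[OF u])
  show "ennreal (L u) \<le> (\<Sum>i. open_mass (U i))"
  proof (rule ennreal_le_epsilon)
    fix e :: real assume "0 < e"
    define C where "C = K \<inter> {x \<in> topspace X. e \<le> u x}"
    have C: "compactin X C"
      unfolding C_def using u' by (rule compactin_level)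
    have "C \<subseteq> (\<Union>i. U i)"
      using u \<open>0 < e\<close> K_subset by (force simp: C_def bumps_def)
    then obtain F where "finite F" "F \<subseteq> range U" "C \<subseteq> \<Union>F"
      using C U unfolding compactin_def by (metis (mono_tags, lifting) imageE)
    then obtain I where I: "finite I" "C \<subseteq> (\<Union>i\<in>I. U i)"
      by (metis finite_subset_image)
    define n where "n = Suc (Max (insert 0 I))"
    have "I \<subseteq> {..<n}"
      using I(1) by (auto simp: n_def less_Suc_eq_le)
    then have "C \<subseteq> (\<Union>i<n. U i)"
      using I(2) by blast
    then obtain g where g: "g \<in> bumps X (\<Union>i<n. U i)" "\<And>x. x \<in> C \<Longrightarrow> g x = 1"
      using bump_exists[OF locally_compact Hausdorff C] U
      by (metis (no_types, lifting) imageE openin_Union)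
    note n = bumpsD(1)[OF g(1)]
    have le: "u x \<le> e + g x" if "x \<in> K" for x
    proof -
      have x: "x \<in> topspace X" using that K_subset by blast
      show ?thesis
        using bumpsD(2)[OF g(1) x] bumpsD(3)[OF u x] g(2)[of x] that x \<open>0 < e\<close>
        by (cases "u x < e") (auto simp: C_def)
    qed
    have "L u \<le> L (\<lambda>x. e + g x)"
      using le u' n \<open>0 < e\<close> by (intro L_mono nonneg_cont_add nonneg_cont_const) auto
    also have "\<dots> = e + L g"
      using n \<open>0 < e\<close> by (simp add: L_add L_const nonneg_cont_const)
    finally have "ennreal (L u) \<le> ennreal (L g) + ennreal e"
      using n \<open>0 < e\<close> by (simp add: L_nonneg ennreal_leI ennreal_plus[symmetric] add.commute del: ennreal_plus)
    also have "ennreal (L g) \<le> (\<Sum>i<n. open_mass (U i))"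
      using L_le_open_mass[OF g(1)] open_mass_finite_UN[of U n, OF U] by (rule order_trans)
    also have "\<dots> \<le> (\<Sum>i. open_mass (U i))"
      by (rule sum_le_suminf) auto
    finally show "ennreal (L u) \<le> (\<Sum>i. open_mass (U i)) + ennreal e"
      by (simp add: add_right_mono)
  qed
qed

definition outer :: "'v set \<Rightarrow> ennreal" where
  "outer E = (INF U\<in>{U. openin X U \<and> E \<subseteq> U}. open_mass U)"

lemma outer_open: "openin X U \<Longrightarrow> outer U = open_mass U"
  unfolding outer_def by (intro antisym INF_lower INF_greatest) (auto intro: open_mass_mono)

lemma outer_mono: "E \<subseteq> F \<Longrightarrow> outer E \<le> outer F"
  unfolding outer_def by (rule INF_superset_mono) auto

lemma outer_le: "openin X U \<Longrightarrow> E \<subseteq> U \<Longrightarrow> outer E \<le> open_mass U"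
  unfolding outer_def by (rule INF_lower) simp

lemma outer_close:
  assumes "outer E < c"
  obtains U where "openin X U" "E \<subseteq> U" "open_mass U < c"
  using assms unfolding outer_def by (auto simp: INF_less_iff)

lemma open_mass_le_1: "open_mass U \<le> 1"
  unfolding open_mass_def
proof (rule SUP_least)
  fix u assume "u \<in> bumps X U"
  then have "L u \<le> L (\<lambda>_. 1)"
    using K_subset by (intro L_mono) (auto simp: bumps_def nonneg_cont_const)
  then show "ennreal (L u) \<le> 1"
    by (simp add: L_one)
qed

lemma outer_le_1: "E \<subseteq> topspace X \<Longrightarrow> outer E \<le> 1"
  using outer_le[of "topspace X" E] open_mass_le_1 by (auto intro: order_trans)

lemma outer_measure_space_outer: "outer_measure_space (Pow (topspace X)) outer"
  unfolding outer_measure_space_def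
proof (intro conjI)
  show "positive (Pow (topspace X)) outer"
    by (simp add: positive_def outer_open open_mass_eq_0)
  show "increasing (Pow (topspace X)) outer"
    by (simp add: increasing_def outer_mono)
  show "countably_subadditive (Pow (topspace X)) outer"
    unfolding countably_subadditive_def
  proof (intro allI impI)
    fix A :: "nat \<Rightarrow> 'v set"
    assume A: "range A \<subseteq> Pow (topspace X)"
    show "outer (\<Union>i. A i) \<le> (\<Sum>i. outer (A i))"
    proof (rule ennreal_le_epsilon)
      fix e :: real assume e: "0 < e"
      have "\<exists>U. openin X U \<and> A i \<subseteq> U \<and> open_mass U \<le> outer (A i) + ennreal (e * (1/2) ^ Suc i)" for i
      proof -
        have "outer (A i) < top"
          using A by (intro le_less_trans[OF outer_le_1 ennreal_one_less_top]) auto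
        then have "outer (A i) < outer (A i) + ennreal (e * (1/2) ^ Suc i)"
          using e by (simp add: ennreal_add_left_cancel_less[of _ 0, simplified])
        then obtain U where "openin X U" "A i \<subseteq> U"
            "open_mass U < outer (A i) + ennreal (e * (1/2) ^ Suc i)"
          by (rule outer_close)
        then show ?thesis
          using less_imp_le by blast
      qed
      then obtain U where U: "\<And>i. openin X (U i)" "\<And>i. A i \<subseteq> U i"
        and le: "\<And>i. open_mass (U i) \<le> outer (A i) + ennreal (e * (1/2) ^ Suc i)"
        by metis
      have "outer (\<Union>i. A i) \<le> open_mass (\<Union>i. U i)"
        using U by (intro outer_le) auto
      also have "\<dots> \<le> (\<Sum>i. open_mass (U i))"
        using U(1) by (rule open_mass_UN)
      also have "\<dots> \<le> (\<Sum>i. outer (A i) + ennreal (e * (1/2) ^ Suc i))"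
        using le by (rule suminf_le) auto
      also have "\<dots> = (\<Sum>i. outer (A i)) + (\<Sum>i. ennreal (e * (1/2) ^ Suc i))"
        by (rule suminf_add[symmetric]) auto
      also have "(\<Sum>i. ennreal (e * (1/2) ^ Suc i)) = ennreal e"
        using e sums_mult[OF power_half_series, of e]
        by (intro suminf_ennreal_eq) auto
      finally show "outer (\<Union>i. A i) \<le> (\<Sum>i. outer (A i)) + ennreal e" .
    qed
  qed
qed

text \<open>
  The inequality that makes open sets Caratheodory measurable. For open \<open>W \<supseteq> E\<close> and a bump \<open>u\<close> of
  \<open>W \<inter> U\<close>, cut off at height \<open>e\<close>: the truncation of \<open>u\<close> lives on the closed set \<open>D\<close> where \<open>e \<le> u\<close>, so
  adding to it any bump of the open set \<open>W - D\<close>, which contains \<open>W - U\<close>, yields a bump of \<open>W\<close>.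
\<close>

lemma outer_split_open:
  assumes U: "openin X U" and E: "E \<subseteq> topspace X"
  shows "outer (E \<inter> U) + outer (E - U) \<le> outer E"
  unfolding outer_def[of E]
proof (rule INF_greatest, clarify)
  fix W assume W: "openin X W" and EW: "E \<subseteq> W"
  have "open_mass (W \<inter> U) + outer (W - U) \<le> open_mass W"
    unfolding open_mass_def[of "W \<inter> U"]
  proof (subst ennreal_SUP_add_left[symmetric], goal_cases)
    case 1
    show ?case using zero_bump by blast
  next
    case 2
    show ?case
    proof (rule SUP_least)
      fix u assume u: "u \<in> bumps X (W \<inter> U)"
      have u': "u \<in> nonneg_cont X" by (rule bumpsD[OF u])
      show "ennreal (L u) + outer (W - U) \<le> open_mass W"
      proof (rule ennreal_le_epsilon)
        fix e :: real assume "0 < e"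
        define D where "D = {x \<in> topspace X. e \<le> u x}"
        have "closedin X D"
          unfolding D_def using u' by (rule closedin_le_nonneg_cont)
        have "D \<subseteq> U"
          using u \<open>0 < e\<close> by (force simp: D_def bumps_def)
        define v where "v = (\<lambda>x. max 0 (u x - e))"
        have v: "v \<in> nonneg_cont X"
          unfolding v_def using u' by (rule nonneg_cont_truncate)
        have "L u \<le> L (\<lambda>x. e + v x)"
          using u' v \<open>0 < e\<close>
          by (intro L_mono nonneg_cont_add nonneg_cont_const) (auto simp: v_def)
        also have "\<dots> = e + L v"
          using v \<open>0 < e\<close> by (simp add: L_add L_const nonneg_cont_const)
        finally have Lu: "ennreal (L u) \<le> ennreal (L v) + ennreal e"
          using v \<open>0 < e\<close>
          by (simp add: L_nonneg ennreal_leI ennreal_plus[symmetric] add.commute del: ennreal_plus)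
        have "ennreal (L v) + open_mass (W - D) \<le> open_mass W"
          unfolding open_mass_def[of "W - D"]
        proof (subst ennreal_SUP_add_right, goal_cases)
          case 1
          show ?case using zero_bump by blast
        next
          case 2
          show ?case
          proof (rule SUP_least)
            fix g assume g: "g \<in> bumps X (W - D)"
            have g': "g \<in> nonneg_cont X" by (rule bumpsD[OF g])
            have "(\<lambda>x. v x + g x) \<in> bumps X W"
              unfolding bumps_def
            proof (safe intro!: nonneg_cont_add v g')
              fix x assume x: "x \<in> topspace X"
              show "v x + g x \<le> 1"
                using bumpsD(2-4)[OF g, of x] bumpsD(2-4)[OF u, of x] x \<open>0 < e\<close>
                by (cases "x \<in> D") (auto simp: v_def D_def)
              show "v x + g x = 0" if "x \<notin> W"
                using bumpsD(2-4)[OF g, of x] bumpsD(2-4)[OF u, of x] x that \<open>0 < e\<close> by (auto simp: v_def)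
            qed
            from L_le_open_mass[OF this] show "ennreal (L v) + ennreal (L g) \<le> open_mass W"
              using v g' by (simp add: L_add L_nonneg)
          qed
        qed
        moreover have "outer (W - U) \<le> open_mass (W - D)"
          using \<open>D \<subseteq> U\<close> W \<open>closedin X D\<close> by (intro outer_le) auto
        ultimately show "ennreal (L u) + outer (W - U) \<le> open_mass W + ennreal e"
          using Lu by (smt (verit) add.assoc add.commute add_mono order_trans order_refl)
      qed
    qed
  qed
  moreover have "outer (E \<inter> U) \<le> open_mass (W \<inter> U)"
    using EW U W by (intro outer_le) auto
  moreover have "outer (E - U) \<le> outer (W - U)"
    using EW by (intro outer_mono) auto
  ultimately show "outer (E \<inter> U) + outer (E - U) \<le> open_mass W"
    by (meson add_mono order_trans)
qed

lemma L_cong: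
  assumes "u \<in> nonneg_cont X" "w \<in> nonneg_cont X" "\<And>x. x \<in> K \<Longrightarrow> u x = w x"
  shows "L u = L w"
  using assms by (intro antisym L_mono) auto

definition riesz_measure :: "'v measure" where
  "riesz_measure = measure_of (topspace X) {U. openin X U} outer"

lemma space_riesz_measure: "space riesz_measure = topspace X"
  and sets_riesz_measure: "sets riesz_measure = sigma_sets (topspace X) {U. openin X U}"
  unfolding riesz_measure_def
  by (intro space_measure_of sets_measure_of; use openin_subset in auto)+

lemma emeasure_riesz_measure:
  assumes "A \<in> sets riesz_measure"
  shows "emeasure riesz_measure A = outer A"
proof -
  let ?\<Omega> = "topspace X"
  interpret P: sigma_algebra ?\<Omega> "Pow ?\<Omega>" by (rule sigma_algebra_Pow)
  define \<Lambda> where "\<Lambda> = lambda_system ?\<Omega> (Pow ?\<Omega>) outer"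
  have \<Lambda>: "measure_space ?\<Omega> \<Lambda> outer"
    unfolding \<Lambda>_def by (rule P.caratheodory_lemma[OF outer_measure_space_outer])
  have "U \<in> \<Lambda>" if U: "openin X U" for U
    unfolding \<Lambda>_def P.lambda_system_eq
  proof (intro CollectI conjI ballI antisym)
    fix E assume "E \<in> Pow ?\<Omega>"
    then have E: "E \<subseteq> ?\<Omega>" by simp
    show "outer (E \<inter> U) + outer (E - U) \<le> outer E"
      using U E by (rule outer_split_open)
    have "subadditive (Pow ?\<Omega>) outer"
      using outer_measure_space_outer P.countably_subadditive_subadditive
      by (auto simp: outer_measure_space_def)
    then have "outer ((E \<inter> U) \<union> (E - U)) \<le> outer (E \<inter> U) + outer (E - U)"
      using E by (intro subadditiveD) auto
    then show "outer E \<le> outer (E \<inter> U) + outer (E - U)"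
      by (simp add: Int_Diff_Un)
  qed (use U openin_subset in auto)
  then have "sigma_sets ?\<Omega> {U. openin X U} \<subseteq> \<Lambda>"
    using \<Lambda> by (intro sigma_algebra.sigma_sets_subset) (auto simp: measure_space_def)
  then have "measure_space ?\<Omega> (sigma_sets ?\<Omega> {U. openin X U}) outer"
    using openin_subset by (intro measure_down[OF \<Lambda>] sigma_algebra_sigma_sets) auto
  then have "positive (sets riesz_measure) outer" "countably_additive (sets riesz_measure) outer"
    by (auto simp: measure_space_def sets_riesz_measure)
  then show ?thesis
    using assms openin_subset by (intro emeasure_measure_of[OF riesz_measure_def]) auto
qed

lemma open_in_riesz: "openin X U \<Longrightarrow> U \<in> sets riesz_measure"
  by (simp add: sets_riesz_measure sigma_sets.Basic)

lemma emeasure_riesz_open: "openin X U \<Longrightarrow> emeasure riesz_measure U = open_mass U"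
  by (simp add: emeasure_riesz_measure open_in_riesz outer_open)

lemma prob_space_riesz_measure: "prob_space riesz_measure"
proof
  have "(\<lambda>_. 1) \<in> bumps X (topspace X)"
    by (simp add: bumps_def nonneg_cont_const)
  from L_le_open_mass[OF this] have "1 \<le> open_mass (topspace X)"
    by (simp add: L_one)
  then show "emeasure riesz_measure (space riesz_measure) = 1"
    using open_mass_le_1[of "topspace X"] by (simp add: space_riesz_measure emeasure_riesz_open)
qed

lemma openin_Compl_K: "openin X (topspace X - K)"
  using compactin_imp_closedin[OF Hausdorff compact] by blast

lemma emeasure_Compl_K: "emeasure riesz_measure (topspace X - K) = 0"
  by (simp add: emeasure_riesz_open openin_Compl_K, rule open_mass_eq_0) blast

lemma AE_in_K: "AE x in riesz_measure. x \<in> K"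
  by (rule AE_I[where N = "topspace X - K"])
     (auto simp: emeasure_Compl_K space_riesz_measure open_in_riesz openin_Compl_K)

lemma borel_measurable_nonneg_cont: "u \<in> nonneg_cont X \<Longrightarrow> u \<in> borel_measurable riesz_measure"
  by (rule borel_measurable_continuous_map[OF space_riesz_measure sets_riesz_measure nonneg_contD(1)])

lemma integrable_bump:
  assumes "u \<in> bumps X U"
  shows "integrable riesz_measure u"
proof -
  interpret prob_space riesz_measure by (rule prob_space_riesz_measure)
  show ?thesis
    using assms borel_measurable_nonneg_cont
    by (intro integrable_const_bound[of _ 1]) (auto simp: bumps_def nonneg_cont_def space_riesz_measure)
qed

text \<open>
  Layer cake: cut \<open>u\<close> into \<open>n\<close> horizontal slices of height \<open>1/n\<close>. After scaling by \<open>n\<close>, slice \<open>k\<close> is a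
  bump of \<open>U k = {k/n < u}\<close>, so \<open>L u\<close> is at most the integral of the step function that takes \<open>1/n\<close> for
  each \<open>U k\<close> containing the point; and that step function exceeds \<open>u\<close> by at most \<open>1/n\<close>.
\<close>

lemma L_bump_le_integral:
  assumes u: "u \<in> bumps X (topspace X)"
  shows "L u \<le> (\<integral>x. u x \<partial>riesz_measure)"
proof -
  interpret prob_space riesz_measure by (rule prob_space_riesz_measure)
  have u': "u \<in> nonneg_cont X" by (rule bumpsD[OF u])
  have "L u \<le> (\<integral>x. u x \<partial>riesz_measure) + 1 / real n" if "0 < n" for n :: nat
  proof -
    define slice where "slice k x = min (1 / n) (max 0 (u x - k / n))" for k :: nat and x
    define U where "U k = {x \<in> topspace X. k / n < u x}" for k :: nat
    have U: "openin X (U k)" for k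
      unfolding U_def using u' by (rule openin_less_nonneg_cont)
    have slice: "slice k \<in> nonneg_cont X" for k
      unfolding slice_def by (intro nonneg_cont_min nonneg_cont_const nonneg_cont_truncate u') simp
    have split: "min a t + min c (max 0 (t - a)) = min (a + c) t" if "0 \<le> c" for a c t :: real
      using that by (auto simp: min_def max_def)
    have sum_slice: "(\<Sum>k<m. slice k x) = min (m / n) (u x)" if "x \<in> topspace X" for m x
    proof (induction m)
      case 0
      show ?case using nonneg_contD(2)[OF u' that] by simp
    next
      case (Suc m)
      have "(\<Sum>k<Suc m. slice k x) = min (m / n) (u x) + min (1 / n) (max 0 (u x - m / n))"
        by (simp add: Suc.IH) (simp add: slice_def)
      also have "\<dots> = min (m / n + 1 / n) (u x)"
        by (rule split) simp
      finally show ?case by (simp add: add_divide_distrib add.commute)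
    qed
    have L_slice: "L (slice k) \<le> measure riesz_measure (U k) / n" for k
    proof -
      have "slice k x \<le> 1 / n" for x
        by (simp add: slice_def)
      moreover have "slice k x = 0" if "u x \<le> k / n" for x
        using that by (simp add: slice_def)
      then have "k / n < u x" if "slice k x \<noteq> 0" for x
        using that not_less by blast
      ultimately have "(\<lambda>x. n * slice k x) \<in> bumps X (U k)"
        using \<open>0 < n\<close> slice[of k]
        by (auto simp: bumps_def U_def nonneg_cont_scale pos_le_divide_eq mult.commute not_less)
      then have "ennreal (L (\<lambda>x. n * slice k x)) \<le> measure riesz_measure (U k)"
        using L_le_open_mass[of _ "U k"] U by (simp add: emeasure_riesz_open[symmetric] emeasure_eq_measure)
      then have "n * L (slice k) \<le> measure riesz_measure (U k)"
        using slice[of k] by (simp add: L_scale)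
      then show ?thesis using \<open>0 < n\<close> by (simp add: field_simps)
    qed
    have count: "(\<Sum>k<m. indicat_real (U k) x / n) \<le> 1 / n + u x" if x: "x \<in> topspace X" for m x
    proof (induction m)
      case 0
      show ?case using nonneg_contD(2)[OF u' that] by simp
    next
      case (Suc m)
      show ?case
      proof (cases "x \<in> U m")
        case True
        have "(\<Sum>k<Suc m. indicat_real (U k) x / n) \<le> (\<Sum>k<Suc m. 1 / n)"
          by (intro sum_mono divide_right_mono) (auto simp: indicator_def)
        also have "\<dots> = 1 / n + m / n"
          by (simp add: add_divide_distrib)
        also have "\<dots> \<le> 1 / n + u x"
          using True by (auto simp: U_def)
        finally show ?thesis .
      qed (use Suc in simp)
    qed
    have "L u = L (\<lambda>x. \<Sum>k<n. slice k x)"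
      using K_subset bumpsD(3)[OF u] \<open>0 < n\<close>
      by (intro L_cong u' nonneg_cont_sum slice) (auto simp: sum_slice)
    also have "\<dots> = (\<Sum>k<n. L (slice k))"
      by (rule L_sum) (auto simp: slice)
    also have "\<dots> \<le> (\<Sum>k<n. measure riesz_measure (U k) / n)"
      by (intro sum_mono L_slice)
    also have "\<dots> = (\<integral>x. (\<Sum>k<n. indicat_real (U k) x / n) \<partial>riesz_measure)"
      using open_in_riesz[OF U] sets.Int_space_eq2
      by (subst Bochner_Integration.integral_sum) (auto simp: less_top[symmetric])
    also have "\<dots> \<le> (\<integral>x. 1 / n + u x \<partial>riesz_measure)"
      using open_in_riesz[OF U] integrable_bump[OF u] count
      by (intro integral_mono Bochner_Integration.integrable_sum Bochner_Integration.integrable_add)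
         (auto simp: less_top[symmetric] space_riesz_measure)
    also have "\<dots> = (\<integral>x. u x \<partial>riesz_measure) + 1 / n"
      using integrable_bump[OF u] by (simp add: prob_space)
    finally show ?thesis .
  qed
  then have "L u - (\<integral>x. u x \<partial>riesz_measure) \<le> 1 / Suc n" for n
    using zero_less_Suc[of n] by (metis add.commute diff_le_eq)
  moreover have "(\<lambda>n. 1 / Suc n) \<longlonglongrightarrow> 0"
    using LIMSEQ_inverse_real_of_nat by (simp add: inverse_eq_divide)
  ultimately have "L u - (\<integral>x. u x \<partial>riesz_measure) \<le> 0"
    by (meson LIMSEQ_le_const)
  then show ?thesis by simp
qed

text \<open>
  Apply the inequality to \<open>u\<close> and to \<open>1 - u\<close>.
\<close>

lemma L_bump_eq_integral:
  assumes u: "u \<in> bumps X (topspace X)"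
  shows "L u = (\<integral>x. u x \<partial>riesz_measure)"
proof -
  interpret prob_space riesz_measure by (rule prob_space_riesz_measure)
  have u': "u \<in> nonneg_cont X" by (rule bumpsD[OF u])
  have v: "(\<lambda>x. 1 - u x) \<in> bumps X (topspace X)"
    using u by (auto simp: bumps_def nonneg_cont_def intro!: continuous_map_diff)
  have "L u + L (\<lambda>x. 1 - u x) = 1"
    using L_add[OF u' bumpsD(1)[OF v]] by (simp add: L_one)
  moreover have "(\<integral>x. 1 - u x \<partial>riesz_measure) = 1 - (\<integral>x. u x \<partial>riesz_measure)"
    using integrable_bump[OF u] by (simp add: prob_space)
  ultimately show ?thesis
    using L_bump_le_integral[OF u] L_bump_le_integral[OF v] by linarith
qed

text \<open>
  Both sides ignore what happens outside \<open>K\<close>, where \<open>u\<close> is bounded; truncation and scaling turn \<open>u\<close>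
  into a bump.
\<close>

theorem L_eq_integral:
  assumes u: "u \<in> nonneg_cont X"
  shows "L u = (\<integral>x. u x \<partial>riesz_measure)"
proof -
  have "compact (u ` K)"
    using image_compactin[OF compact nonneg_contD(1)[OF u]] by simp
  then obtain b where b: "\<And>x. x \<in> K \<Longrightarrow> u x \<le> b"
    using bounded_imp_bdd_above[OF compact_imp_bounded] by (fastforce simp: bdd_above_def)
  \<comment> \<open>The maximum with \<open>1\<close> keeps \<open>c\<close> positive, so that one may divide by it.\<close>
  define c where "c = max 1 b"
  have c: "0 < c" "\<And>x. x \<in> K \<Longrightarrow> u x \<le> c"
    using b by (auto simp: c_def max.coboundedI2)
  define w where "w = (\<lambda>x. min 1 ((1 / c) * u x))"
  have w: "w \<in> bumps X (topspace X)"
    using nonneg_cont_min[OF nonneg_cont_const[of 1] nonneg_cont_scale[of "1 / c", OF _ u]] c(1)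
    unfolding w_def bumps_def by auto
  have uw: "u x = c * w x" if "x \<in> K" for x
    using c(1) c(2)[OF that] by (simp add: w_def min_def field_simps)
  have "L u = L (\<lambda>x. c * w x)"
    using c(1) uw by (intro L_cong u nonneg_cont_scale bumpsD[OF w]) auto
  also have "\<dots> = c * (\<integral>x. w x \<partial>riesz_measure)"
    using c(1) bumpsD(1)[OF w] by (simp add: L_scale L_bump_eq_integral[OF w])
  also have "\<dots> = (\<integral>x. c * w x \<partial>riesz_measure)"
    by simp
  also have "\<dots> = (\<integral>x. u x \<partial>riesz_measure)"
    using AE_in_K u nonneg_cont_scale[OF less_imp_le[OF c(1)] bumpsD(1)[OF w]]
    by (intro integral_cong_AE borel_measurable_nonneg_cont) (auto simp: uw)
  finally show ?thesis .
qed

text \<open>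
  Approximate the complement of \<open>B\<close> by open sets from outside, take complements and intersect them
  with \<open>K\<close>, which has full measure.
\<close>

lemma riesz_inner_regular:
  assumes B: "B \<in> sets riesz_measure"
  shows "emeasure riesz_measure B = (SUP C\<in>{C. compactin X C \<and> C \<subseteq> B}. emeasure riesz_measure C)"
proof (rule antisym)
  interpret prob_space riesz_measure by (rule prob_space_riesz_measure)
  show "(SUP C\<in>{C. compactin X C \<and> C \<subseteq> B}. emeasure riesz_measure C) \<le> emeasure riesz_measure B"
    using B by (auto intro!: SUP_least emeasure_mono)
  show "emeasure riesz_measure B \<le> (SUP C\<in>{C. compactin X C \<and> C \<subseteq> B}. emeasure riesz_measure C)"
  proof (rule ennreal_le_epsilon)
    fix e :: real assume "0 < e"
    have BX: "B \<subseteq> topspace X"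
      using sets.sets_into_space[OF B] by (simp add: space_riesz_measure)
    have cB: "topspace X - B \<in> sets riesz_measure"
      using sets.compl_sets[OF B] by (simp add: space_riesz_measure)
    have "outer (topspace X - B) = measure riesz_measure (topspace X - B)"
      using cB by (simp add: emeasure_riesz_measure[symmetric] emeasure_eq_measure)
    also have "\<dots> < ennreal (measure riesz_measure (topspace X - B) + e)"
      using \<open>0 < e\<close> by (simp add: ennreal_less_iff)
    finally obtain U where U: "openin X U" "topspace X - B \<subseteq> U"
      and lt: "open_mass U < ennreal (measure riesz_measure (topspace X - B) + e)"
      by (rule outer_close)
    have mU: "measure riesz_measure U \<le> measure riesz_measure (topspace X - B) + e"
      using lt \<open>0 < e\<close>
      by (simp add: emeasure_riesz_open[OF U(1), symmetric] emeasure_eq_measure ennreal_less_iff del: ennreal_plus)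
    define C where "C = K \<inter> (topspace X - U)"
    have C: "compactin X C" "C \<subseteq> B"
      using U BX by (auto simp: C_def intro!: compact_Int_closedin[OF compact])
    have "emeasure riesz_measure C = emeasure riesz_measure (topspace X - U)"
    proof (rule emeasure_eq_AE)
      show "AE x in riesz_measure. x \<in> C \<longleftrightarrow> x \<in> topspace X - U"
        using AE_in_K by eventually_elim (auto simp: C_def)
      show XU: "topspace X - U \<in> sets riesz_measure"
        using sets.compl_sets[OF open_in_riesz[OF U(1)]] by (simp add: space_riesz_measure)
      have "K = space riesz_measure - (topspace X - K)"
        using K_subset by (auto simp: space_riesz_measure)
      also have "\<dots> \<in> sets riesz_measure"
        by (intro sets.compl_sets open_in_riesz openin_Compl_K)
      finally show "C \<in> sets riesz_measure"
        using XU by (auto simp: C_def)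
    qed
    moreover have "measure riesz_measure B \<le> measure riesz_measure (topspace X - U) + e"
      using mU prob_compl[OF B] prob_compl[OF open_in_riesz[OF U(1)]]
      by (simp add: space_riesz_measure)
    ultimately have "emeasure riesz_measure B \<le> emeasure riesz_measure C + ennreal e"
      using \<open>0 < e\<close> by (simp add: emeasure_eq_measure ennreal_plus[symmetric] del: ennreal_plus)
    also have "\<dots> \<le> (SUP C\<in>{C. compactin X C \<and> C \<subseteq> B}. emeasure riesz_measure C) + ennreal e"
      using C by (intro add_right_mono SUP_upper) auto
    finally show "emeasure riesz_measure B \<le> \<dots>" .
  qed
qed

theorem riesz_measure_compact_radon_probability: "riesz_measure \<in> compact_radon_probabilities X"
proof -
  interpret prob_space riesz_measure by (rule prob_space_riesz_measure)
  have "measure_support X riesz_measure \<subseteq> K"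
    using openin_Compl_K emeasure_Compl_K by (fastforce simp: measure_support_def)
  then have "compactin X (measure_support X riesz_measure)"
    by (rule closed_compactin[OF compact _ closedin_measure_support])
  moreover have "radon_measure X riesz_measure"
    unfolding radon_measure_def
  proof (intro conjI ballI)
    show "\<exists>U. openin X U \<and> x \<in> U \<and> emeasure riesz_measure U < \<infinity>" if "x \<in> topspace X" for x
      using that by (intro exI[of _ "topspace X"]) (simp add: less_top[symmetric])
  qed (auto simp: space_riesz_measure sets_riesz_measure riesz_inner_regular)
  ultimately show ?thesis
    using prob_space_axioms by (simp add: compact_radon_probabilities_def)
qed

end

section \<open>Continuous maps into powers of the half-line\<close>

lemma nhdsin_euclidean: "nhdsin euclidean x = nhds x"
  by (simp add: filter_eq_iff eventually_nhdsin eventually_nhds)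

lemma points_simps [simp]:
  "points (ctop T) = topspace T"
  "points cRplus = {0..}"
  "points (cprod I Y) = (\<Pi>\<^sub>E i\<in>I. points (Y i))"
  "points (chom X Z) = cmaps X Z"
  "points (csub Z A) = points Z \<inter> A"
  by (auto simp: ctop_def cRplus_def cprod_def chom_def csub_def)

lemma cmapsD:
  assumes "f \<in> cmaps Y Z"
  shows "x \<in> points Y \<Longrightarrow> f x \<in> points Z"
    and "f \<in> extensional (points Y)"
    and "converges Y F x \<Longrightarrow> converges Z (filtermap f F) (f x)"
  using assms by (auto simp: cmaps_def PiE_iff)

text \<open>
  The points of \<open>(\<real>\<^sub>+\<^sup>k)\<^sup>n\<close>; the first index is the outer one and ranges below \<open>n\<close>.
\<close>

definition grid :: "nat \<Rightarrow> nat \<Rightarrow> (nat \<Rightarrow> nat \<Rightarrow> real) set" where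
  "grid k n = (\<Pi>\<^sub>E i\<in>{..<n}. \<Pi>\<^sub>E j\<in>{..<k}. {0..})"

lemma points_grid: "points (cpower (cpower cRplus k) n) = grid k n"
  by (simp add: grid_def)

lemma grid_nonneg: "x \<in> grid k n \<Longrightarrow> i < n \<Longrightarrow> j < k \<Longrightarrow> 0 \<le> x i j"
  by (fastforce simp: grid_def PiE_iff)

lemma grid_ext:
  assumes "x \<in> grid k n" "y \<in> grid k n" "\<And>i j. i < n \<Longrightarrow> j < k \<Longrightarrow> x i j = y i j"
  shows "x = y"
  using assms unfolding grid_def
  by (intro PiE_ext[of x "{..<n}" _ y]) (auto intro!: PiE_ext[where k = "{..<k}"] dest: PiE_mem)

lemma restrict_in_grid:
  "(\<And>i j. i < n \<Longrightarrow> j < k \<Longrightarrow> 0 \<le> x i j) \<Longrightarrow> (\<lambda>i\<in>{..<n}. \<lambda>j\<in>{..<k}. x i j) \<in> grid k n"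
  by (auto simp: grid_def)

lemma converges_cRplus_filtermap:
  "converges cRplus (filtermap g F) y \<longleftrightarrow>
     0 \<le> y \<and> F \<noteq> bot \<and> (\<forall>\<^sub>F z in F. 0 \<le> g z) \<and> (g \<longlongrightarrow> y) F"
  by (simp add: cRplus_def csub_def ctop_def filter_on_def nhdsin_euclidean le_principal
      eventually_filtermap filtermap_bot_iff filterlim_def conj_ac)

lemma converges_cprod_filtermap:
  "converges (cprod I W) (filtermap g F) y \<longleftrightarrow>
     y \<in> points (cprod I W) \<and> F \<noteq> bot \<and> (\<forall>\<^sub>F z in F. g z \<in> points (cprod I W)) \<and>
     (\<forall>i\<in>I. converges (W i) (filtermap (\<lambda>z. g z i) F) (y i))"
  by (simp add: cprod_def filter_on_def le_principal eventually_filtermap filtermap_bot_iff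
      filtermap_filtermap conj_ac)

text \<open>
  Convergence in iterated powers of \<open>\<real>\<^sub>+\<close> is convergence of the real entries. It is stated for image
  filters, since continuity only ever asks about these.
\<close>

lemma converges_grid:
  "converges (cpower (cpower cRplus k) n) (filtermap g F) x \<longleftrightarrow>
     x \<in> grid k n \<and> F \<noteq> bot \<and> (\<forall>\<^sub>F z in F. g z \<in> grid k n) \<and>
     (\<forall>i<n. \<forall>j<k. ((\<lambda>z. g z i j) \<longlongrightarrow> x i j) F)" (is "?lhs \<longleftrightarrow> ?rhs")
proof (cases "x \<in> grid k n \<and> F \<noteq> bot \<and> (\<forall>\<^sub>F z in F. g z \<in> grid k n)")
  case True
  then have ev: "\<forall>\<^sub>F z in F. g z \<in> grid k n" by blast
  have row: "\<forall>\<^sub>F z in F. g z i \<in> (\<Pi>\<^sub>E j\<in>{..<k}. {0..})" if "i < n" for i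
    using ev by eventually_elim (use that in \<open>auto simp: grid_def\<close>)
  have cell: "\<forall>\<^sub>F z in F. 0 \<le> g z i j" if "i < n" "j < k" for i j
    using ev by eventually_elim (use that in \<open>auto intro: grid_nonneg\<close>)
  have "x i \<in> (\<Pi>\<^sub>E j\<in>{..<k}. {0..})" if "i < n" for i
    using True that unfolding grid_def by blast
  then show ?thesis
    using True row cell grid_nonneg[of x k n]
    unfolding converges_cprod_filtermap converges_cRplus_filtermap points_grid[of k n]
    by (auto simp: grid_def[symmetric])
next
  case False
  then show ?thesis
    unfolding converges_cprod_filtermap[of "{..<n}"] points_grid by blast
qed

text \<open>
  The axiom of convergence spaces that convergent filters live on the carrier. It turns pointwise
  statements on the carrier into eventual ones along a convergent filter.
\<close>

definition supported :: "'a cspace \<Rightarrow> bool" where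
  "supported Z \<longleftrightarrow> (\<forall>F x. converges Z F x \<longrightarrow> x \<in> points Z \<and> filter_on (points Z) F)"

lemma supported_intros:
  "supported (ctop T)" "supported (chom X Z)" "supported (cprod I W)"
  by (auto simp: supported_def ctop_def chom_def cprod_def)

lemma cmaps_grid_iff:
  assumes "supported Z"
  shows "f \<in> cmaps Z (cpower (cpower cRplus k) n) \<longleftrightarrow> f \<in> points Z \<rightarrow>\<^sub>E grid k n \<and>
    (\<forall>F x. converges Z F x \<longrightarrow> (\<forall>i<n. \<forall>j<k. ((\<lambda>z. f z i j) \<longlongrightarrow> f x i j) F))"
    (is "?lhs \<longleftrightarrow> ?rhs")
proof
  assume ?lhs then show ?rhs
    unfolding cmaps_def points_grid by (auto simp: converges_grid)
next
  assume r: ?rhs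
  then have f: "f \<in> points Z \<rightarrow>\<^sub>E grid k n" by blast
  have "converges (cpower (cpower cRplus k) n) (filtermap f F) (f x)" if "converges Z F x" for F x
    unfolding converges_grid
  proof (intro conjI)
    have "\<forall>\<^sub>F z in F. z \<in> points Z"
      using assms that by (auto simp: supported_def filter_on_def le_principal)
    then show "\<forall>\<^sub>F z in F. f z \<in> grid k n"
      by eventually_elim (use f in auto)
  qed (use r that assms in \<open>auto simp: supported_def filter_on_def\<close>)
  with f show ?lhs
    unfolding cmaps_def points_grid by blast
qed

text \<open>
  Neighbourhood filters are the test filters that recover topological continuity from continuity in
  the sense of convergence spaces.
\<close>

lemma converges_nhdsin:
  assumes "x \<in> topspace T"
  shows "converges (ctop T) (nhdsin T x) x"
proof -
  have "nhdsin T x \<noteq> bot"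
    using assms by (auto simp: trivial_limit_def eventually_nhdsin)
  moreover have "nhdsin T x \<le> principal (topspace T)"
    unfolding le_principal eventually_nhdsin using assms by blast
  ultimately show ?thesis
    using assms by (simp add: ctop_def filter_on_def)
qed

lemma continuous_map_iff_converges:
  fixes u :: "'v \<Rightarrow> real"
  shows "continuous_map T euclideanreal u \<longleftrightarrow>
    (\<forall>F x. converges (ctop T) F x \<longrightarrow> (u \<longlongrightarrow> u x) F)"
proof (intro iffI allI impI)
  fix F x assume u: "continuous_map T euclideanreal u" and "converges (ctop T) F x"
  then have x: "x \<in> topspace T" and F: "F \<le> nhdsin T x"
    by (auto simp: ctop_def)
  have "(u \<longlongrightarrow> u x) (nhdsin T x)"
  proof (rule topological_tendstoI)
    fix S assume "open S" "u x \<in> S"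
    then show "\<forall>\<^sub>F y in nhdsin T x. u y \<in> S"
      using openin_continuous_map_preimage[OF u, of S] x
      by (auto simp: eventually_nhdsin intro!: exI[of _ "{y \<in> topspace T. u y \<in> S}"])
  qed
  with F show "(u \<longlongrightarrow> u x) F"
    by (rule tendsto_mono)
next
  assume r: "\<forall>F x. converges (ctop T) F x \<longrightarrow> (u \<longlongrightarrow> u x) F"
  have "openin T {x \<in> topspace T. u x \<in> S}" if "open S" for S
  proof (subst openin_subopen, safe)
    fix x assume x: "x \<in> topspace T" "u x \<in> S"
    have "\<forall>\<^sub>F y in nhdsin T x. u y \<in> S"
      using r converges_nhdsin[OF x(1)] that x(2) by (blast dest: topological_tendstoD)
    then obtain W where "openin T W" "x \<in> W" "\<forall>y\<in>W. u y \<in> S"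
      using x(1) by (auto simp: eventually_nhdsin)
    then show "\<exists>W. openin T W \<and> x \<in> W \<and> W \<subseteq> {x \<in> topspace T. u x \<in> S}"
      using openin_subset by blast
  qed
  then show "continuous_map T euclideanreal u"
    by (simp add: continuous_map_def)
qed

lemma cmaps_ctop_grid_iff:
  "f \<in> cmaps (ctop T) (cpower (cpower cRplus k) n) \<longleftrightarrow> f \<in> topspace T \<rightarrow>\<^sub>E grid k n \<and>
    (\<forall>i<n. \<forall>j<k. continuous_map T euclideanreal (\<lambda>v. f v i j))"
  unfolding cmaps_grid_iff[OF supported_intros(1)] continuous_map_iff_converges by auto

section \<open>The commutant consists of affine maps\<close>

lemma alg_hom_iff:
  "\<alpha> \<in> points (alg_hom T A B) \<longleftrightarrow> (\<forall>n. \<alpha> n \<in> cmaps (obj A n) (obj B n)) \<and>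
    (\<forall>n m. \<forall>h\<in>points (hom T n m). \<forall>x\<in>points (obj A n).
      act B n m h (\<alpha> n x) = \<alpha> m (act A n m h x))"
  unfolding alg_hom_def by (auto simp: PiE_iff)

lemma points_hom_mat_aff:
  "points (hom mat_aff n m) = {a \<in> ({..<m} \<times> {..<n}) \<rightarrow>\<^sub>E {0..}. \<forall>j<m. (\<Sum>i<n. a (j, i)) = 1}"
  by (auto simp: mat_aff_def)

lemma obj_alg_power: "obj (alg_power Rplus_alg n) k = cpower (cpower cRplus k) n"
  by (simp add: alg_power_def Rplus_alg_def)

lemma act_alg_power:
  assumes "x \<in> grid k n"
  shows "act (alg_power Rplus_alg n) k l h x = (\<lambda>i\<in>{..<n}. \<lambda>j\<in>{..<l}. \<Sum>p<k. h (j, p) * x i p)"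
  using assms by (auto simp: alg_power_def Rplus_alg_def grid_def fun_eq_iff restrict_def)

text \<open>
  The name is justified by \<open>affine_op_in\<close> and \<open>affine_maps_affine\<close> below.
\<close>

abbreviation affine_maps :: "(nat \<Rightarrow> (nat \<Rightarrow> nat \<Rightarrow> real) \<Rightarrow> nat \<Rightarrow> nat \<Rightarrow> real) cthy" where
  "affine_maps \<equiv> commutant mat_aff Rplus_alg"

lemma affine_maps_hom_iff:
  "\<beta> \<in> points (hom affine_maps n m) \<longleftrightarrow>
    (\<forall>k. \<beta> k \<in> cmaps (cpower (cpower cRplus k) n) (cpower (cpower cRplus k) m)) \<and>
    (\<forall>k l. \<forall>h\<in>points (hom mat_aff k l). \<forall>x\<in>grid k n.
      (\<lambda>i\<in>{..<m}. \<lambda>j\<in>{..<l}. \<Sum>p<k. h (j, p) * \<beta> k x i p) =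
      \<beta> l (\<lambda>i\<in>{..<n}. \<lambda>j\<in>{..<l}. \<Sum>p<k. h (j, p) * x i p))" (is "_ \<longleftrightarrow> ?A \<and> ?B")
proof -
  have "\<beta> \<in> points (hom affine_maps n m) \<longleftrightarrow> ?A \<and> (\<forall>k l. \<forall>h\<in>points (hom mat_aff k l). \<forall>x\<in>grid k n.
      act (alg_power Rplus_alg m) k l h (\<beta> k x) = \<beta> l (act (alg_power Rplus_alg n) k l h x))"
    by (simp only: commutant_def cthy.simps alg_hom_iff obj_alg_power points_grid)
  also have "\<dots> \<longleftrightarrow> ?A \<and> ?B"
  proof (rule conj_cong[OF refl])
    assume A: ?A
    have "\<beta> k x \<in> grid k m" if "x \<in> grid k n" for k x
      using A that cmapsD(1)[of "\<beta> k"] by (metis points_grid)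
    then show "(\<forall>k l. \<forall>h\<in>points (hom mat_aff k l). \<forall>x\<in>grid k n.
      act (alg_power Rplus_alg m) k l h (\<beta> k x) = \<beta> l (act (alg_power Rplus_alg n) k l h x)) \<longleftrightarrow> ?B"
      by (simp add: act_alg_power)
  qed
  finally show ?thesis .
qed

text \<open>
  The operation \<open>x \<mapsto> c + (\<Sum>l<n. a l * x l)\<close> on \<open>\<real>\<^sub>+\<close>, extended entrywise to all powers \<open>\<real>\<^sub>+\<^sup>k\<close>.
\<close>

definition affine_op :: "nat \<Rightarrow> real \<Rightarrow> (nat \<Rightarrow> real) \<Rightarrow> nat \<Rightarrow> (nat \<Rightarrow> nat \<Rightarrow> real) \<Rightarrow> nat \<Rightarrow> nat \<Rightarrow> real" where
  "affine_op n c a = (\<lambda>k. \<lambda>x\<in>grid k n. \<lambda>i\<in>{..<1}. \<lambda>p\<in>{..<k}. c + (\<Sum>l<n. a l * x l p))"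

text \<open>
  A matrix whose rows sum to \<open>1\<close> fixes constant vectors, so it commutes with adding the constant
  \<open>c\<close>, and by linearity it commutes with the rest.
\<close>

lemma affine_op_in:
  assumes "0 \<le> c" "\<And>l. 0 \<le> a l"
  shows "affine_op n c a \<in> points (hom affine_maps n 1)"
  unfolding affine_maps_hom_iff
proof (intro conjI allI ballI)
  have val: "affine_op n c a k x \<in> grid k 1" if "x \<in> grid k n" for k x
    using that assms by (auto simp: affine_op_def grid_nonneg intro!: restrict_in_grid add_nonneg_nonneg sum_nonneg)
  show "affine_op n c a k \<in> cmaps (cpower (cpower cRplus k) n) (cpower (cpower cRplus k) 1)" for k
    unfolding cmaps_grid_iff[OF supported_intros(3)] points_grid
  proof (intro conjI allI impI)
    show "affine_op n c a k \<in> grid k n \<rightarrow>\<^sub>E grid k 1"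
      using val by (auto simp: affine_op_def)
    fix F x and i j :: nat
    assume conv: "converges (cpower (cpower cRplus k) n) F x" and ij: "i < 1" "j < k"
    have x: "x \<in> grid k n" and ev: "\<forall>\<^sub>F z in F. z \<in> grid k n"
      and lim: "\<And>l. l < n \<Longrightarrow> ((\<lambda>z. z l j) \<longlongrightarrow> x l j) F"
      using conv ij converges_grid[where k = k and n = n and g = "\<lambda>z. z" and F = F and x = x] by (auto simp: filtermap_ident)
    have "((\<lambda>z. c + (\<Sum>l<n. a l * z l j)) \<longlongrightarrow> c + (\<Sum>l<n. a l * x l j)) F"
      by (intro tendsto_intros lim) auto
    then show "((\<lambda>z. affine_op n c a k z i j) \<longlongrightarrow> affine_op n c a k x i j) F"
    proof (rule Lim_transform_eventually[THEN back_subst[of "\<lambda>y. (_ \<longlongrightarrow> y) F"]])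
      show "\<forall>\<^sub>F z in F. c + (\<Sum>l<n. a l * z l j) = affine_op n c a k z i j"
        using ev by eventually_elim (use ij in \<open>simp add: affine_op_def\<close>)
    qed (use x ij in \<open>simp add: affine_op_def\<close>)
  qed
  fix k l h x
  assume h: "h \<in> points (hom mat_aff k l)" and x: "x \<in> grid k n"
  define y where "y = (\<lambda>i\<in>{..<n}. \<lambda>j\<in>{..<l}. \<Sum>p<k. h (j, p) * x i p)"
  have h0: "0 \<le> h (j, p)" if "j < l" "p < k" for j p
    using h that by (auto simp: points_hom_mat_aff PiE_iff)
  have h1: "(\<Sum>p<k. h (j, p)) = 1" if "j < l" for j
    using h that by (auto simp: points_hom_mat_aff)
  have y: "y \<in> grid l n"
    unfolding y_def
    using x h0 by (intro restrict_in_grid sum_nonneg mult_nonneg_nonneg) (auto simp: grid_nonneg)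
  have "(\<lambda>i\<in>{..<1}. \<lambda>j\<in>{..<l}. \<Sum>p<k. h (j, p) * affine_op n c a k x i p) =
      (\<lambda>i\<in>{..<1}. \<lambda>j\<in>{..<l}. c + (\<Sum>q<n. a q * y q j))"
  proof (intro restrict_ext)
    fix i j assume ij: "i \<in> {..<1::nat}" "j \<in> {..<l}"
    have "(\<Sum>p<k. h (j, p) * affine_op n c a k x i p) = (\<Sum>p<k. h (j, p) * (c + (\<Sum>q<n. a q * x q p)))"
      using x ij by (intro sum.cong) (simp_all add: affine_op_def)
    also have "\<dots> = (\<Sum>p<k. h (j, p)) * c + (\<Sum>p<k. \<Sum>q<n. h (j, p) * (a q * x q p))"
      by (simp add: distrib_left sum.distrib sum_distrib_left sum_distrib_right)
    also have "(\<Sum>p<k. \<Sum>q<n. h (j, p) * (a q * x q p)) = (\<Sum>q<n. a q * (\<Sum>p<k. h (j, p) * x q p))"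
      by (subst sum.swap) (simp add: sum_distrib_left mult.left_commute)
    finally show "(\<Sum>p<k. h (j, p) * affine_op n c a k x i p) = c + (\<Sum>q<n. a q * y q j)"
      using ij by (simp add: h1 y_def)
  qed
  also have "\<dots> = affine_op n c a l y"
    using y by (simp add: affine_op_def)
  finally show "(\<lambda>i\<in>{..<1}. \<lambda>j\<in>{..<l}. \<Sum>p<k. h (j, p) * affine_op n c a k x i p) =
      affine_op n c a l (\<lambda>i\<in>{..<n}. \<lambda>j\<in>{..<l}. \<Sum>p<k. h (j, p) * x i p)"
    by (simp only: y_def)
qed

text \<open>
  Write \<open>e p\<close> for the unit vectors and let \<open>s = 1 + (\<Sum>i<n. y i)\<close>. The vector \<open>y / s\<close> is a convex
  combination of the \<open>e p\<close> and \<open>0\<close>, and also one of \<open>y\<close> and \<open>0\<close>. Comparing the two values of \<open>g\<close> yields the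
  claim. The first assumption says that \<open>g\<close> depends on the first \<open>n\<close> entries only.
\<close>

lemma convex_imp_affine:
  fixes g :: "(nat \<Rightarrow> real) \<Rightarrow> real"
  assumes cong: "\<And>y z. (\<And>i. i < n \<Longrightarrow> y i = z i) \<Longrightarrow> g y = g z"
    and conv: "\<And>(k::nat) t y. (\<And>p. p < k \<Longrightarrow> 0 \<le> t p) \<Longrightarrow> (\<Sum>p<k. t p) = 1 \<Longrightarrow>
      (\<And>p i. p < k \<Longrightarrow> i < n \<Longrightarrow> 0 \<le> y p i) \<Longrightarrow>
      g (\<lambda>i. \<Sum>p<k. t p * y p i) = (\<Sum>p<k. t p * g (y p))"
    and y: "\<And>i. i < n \<Longrightarrow> 0 \<le> y i"
  shows "g y = g (\<lambda>_. 0) + (\<Sum>p<n. (g (\<lambda>i. if i = p then 1 else 0) - g (\<lambda>_. 0)) * y p)"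
proof -
  define s where "s = 1 + (\<Sum>i<n. y i)"
  define e where "e p i = (if i = p then 1 else 0 :: real)" for p i :: nat
  have s: "1 \<le> s"
    unfolding s_def using sum_nonneg[of "{..<n}" y] y by simp
  define t where "t p = (if p < n then y p / s else 1 / s)" for p
  define z where "z p = (if p < n then e p else (\<lambda>_. 0))" for p
  have "g (\<lambda>i. y i / s) = g (\<lambda>i. \<Sum>p<Suc n. t p * z p i)"
  proof (rule cong)
    fix i assume i: "i < n"
    have "(\<Sum>p<n. y p / s * e p i) = (\<Sum>p<n. if p = i then y p / s else 0)"
      by (intro sum.cong) (auto simp: e_def)
    then show "y i / s = (\<Sum>p<Suc n. t p * z p i)"
      using i by (simp add: t_def z_def)
  qed
  also have "\<dots> = (\<Sum>p<Suc n. t p * g (z p))"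
  proof (rule conv)
    show "(\<Sum>p<Suc n. t p) = 1"
      using s by (simp add: t_def sum_divide_distrib[symmetric] add_divide_distrib[symmetric] s_def add.commute)
  qed (use s y in \<open>auto simp: t_def z_def e_def\<close>)
  also have "\<dots> = ((\<Sum>p<n. y p * g (e p)) + g (\<lambda>_. 0)) / s"
    by (simp add: t_def z_def sum_divide_distrib add_divide_distrib)
  finally have 1: "s * g (\<lambda>i. y i / s) = (\<Sum>p<n. y p * g (e p)) + g (\<lambda>_. 0)"
    using s by simp
  have "g (\<lambda>i. y i / s) = g (\<lambda>i. \<Sum>p<2::nat. (if p = 0 then 1 / s else 1 - 1 / s) * (if p = 0 then y else (\<lambda>_. 0)) i)"
    by (intro cong) (simp add: numeral_2_eq_2)
  also have "\<dots> = (\<Sum>p<2::nat. (if p = 0 then 1 / s else 1 - 1 / s) * g (if p = 0 then y else (\<lambda>_. 0)))"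
    using s y by (intro conv) (auto simp: numeral_2_eq_2 split: if_splits)
  also have "\<dots> = g y / s + (1 - 1 / s) * g (\<lambda>_. 0)"
    by (simp add: numeral_2_eq_2)
  finally have 2: "s * g (\<lambda>i. y i / s) = g y + (s - 1) * g (\<lambda>_. 0)"
    using s by (simp add: field_simps)
  have "(\<Sum>p<n. (g (e p) - g (\<lambda>_. 0)) * y p) = (\<Sum>p<n. y p * g (e p)) - (s - 1) * g (\<lambda>_. 0)"
    by (simp add: s_def algebra_simps sum_subtractf sum_distrib_left)
  then show ?thesis
    using 1 2 unfolding e_def by simp
qed

text \<open>
  Naturality with respect to rows of length \<open>k\<close>, regarded as operations \<open>k \<rightarrow> 1\<close>, says that a component
  of \<open>\<beta> 1\<close> preserves convex combinations of \<open>k\<close> points: unit rows identify the entries of \<open>\<beta> k\<close> with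
  values of \<open>\<beta> 1\<close>, and an arbitrary row then combines them.
\<close>

lemma affine_maps_affine:
  assumes \<beta>: "\<beta> \<in> points (hom affine_maps n m)" and j: "j < m"
  obtains c a where "\<And>x. x \<in> grid 1 n \<Longrightarrow> \<beta> 1 x j 0 = c + (\<Sum>i<n. a i * x i 0)"
proof -
  define emb where "emb y = (\<lambda>i\<in>{..<n}. \<lambda>_\<in>{..<1::nat}. y i)" for y :: "nat \<Rightarrow> real"
  define g where "g y = \<beta> 1 (emb y) j 0" for y
  have nat: "(\<Sum>p<k. h (0, p) * \<beta> k x j p) = g (\<lambda>i. \<Sum>p<k. h (0, p) * x i p)"
    if "h \<in> points (hom mat_aff k 1)" "x \<in> grid k n" for k h x
  proof -
    have "(\<lambda>i\<in>{..<m}. \<lambda>j\<in>{..<1}. \<Sum>p<k. h (j, p) * \<beta> k x i p) =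
      \<beta> 1 (\<lambda>i\<in>{..<n}. \<lambda>j\<in>{..<1}. \<Sum>p<k. h (j, p) * x i p)"
      using \<beta> that unfolding affine_maps_hom_iff by blast
    also have "(\<lambda>i\<in>{..<n}. \<lambda>j\<in>{..<1}. \<Sum>p<k. h (j, p) * x i p) = emb (\<lambda>i. \<Sum>p<k. h (0, p) * x i p)"
      unfolding emb_def by (intro restrict_ext) simp
    finally have "(\<lambda>i\<in>{..<m}. \<lambda>j\<in>{..<1}. \<Sum>p<k. h (j, p) * \<beta> k x i p) j 0 =
        \<beta> 1 (emb (\<lambda>i. \<Sum>p<k. h (0, p) * x i p)) j 0"
      by (rule fun_cong[OF fun_cong])
    then show ?thesis
      using j by (simp add: g_def)
  qed
  have conv: "g (\<lambda>i. \<Sum>p<k. t p * y p i) = (\<Sum>p<k. t p * g (y p))"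
    if t: "\<And>p. p < k \<Longrightarrow> 0 \<le> t p" "(\<Sum>p<k. t p) = 1"
    and y: "\<And>p i. p < k \<Longrightarrow> i < n \<Longrightarrow> 0 \<le> y p i" for k :: nat and t y
  proof -
    define x where "x = (\<lambda>i\<in>{..<n}. \<lambda>p\<in>{..<k}. y p i)"
    have x: "x \<in> grid k n"
      unfolding x_def using y by (intro restrict_in_grid)
    define row where "row r = (\<lambda>(q, p)\<in>{..<1::nat} \<times> {..<k}. r p)" for r :: "nat \<Rightarrow> real"
    have row: "row r \<in> points (hom mat_aff k 1)"
      if "\<And>p. p < k \<Longrightarrow> 0 \<le> r p" "(\<Sum>p<k. r p) = 1" for r
      using that by (auto simp: points_hom_mat_aff row_def)
    have row_nat: "(\<Sum>p<k. r p * \<beta> k x j p) = g (\<lambda>i. \<Sum>p<k. r p * y p i)"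
      if "\<And>p. p < k \<Longrightarrow> 0 \<le> r p" "(\<Sum>p<k. r p) = 1" for r
    proof -
      have "g (\<lambda>i. \<Sum>p<k. row r (0, p) * x i p) = g (\<lambda>i. \<Sum>p<k. r p * y p i)"
        unfolding g_def emb_def by (intro arg_cong[of _ _ "\<lambda>z. \<beta> 1 z j 0"] restrict_ext sum.cong)
          (simp_all add: x_def row_def)
      then show ?thesis
        using nat[OF row[OF that] x] by (simp add: row_def)
    qed
    have "\<beta> k x j q = g (y q)" if "q < k" for q
      using row_nat[of "\<lambda>p. if p = q then 1 else 0"] that by (simp add: if_distrib[of "\<lambda>z. z * _"] cong: if_cong)
    then show ?thesis
      using row_nat[OF t] by simp
  qed
  have "\<beta> 1 x j 0 = g (\<lambda>_. 0) + (\<Sum>i<n. (g (\<lambda>q. if q = i then 1 else 0) - g (\<lambda>_. 0)) * x i 0)"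
    if x: "x \<in> grid 1 n" for x
  proof -
    have "emb (\<lambda>i. x i 0) = x"
      using x grid_nonneg[OF x] by (intro grid_ext[OF _ x]) (auto simp: emb_def intro!: restrict_in_grid)
    moreover have "g (\<lambda>i. x i 0) = g (\<lambda>_. 0) + (\<Sum>i<n. (g (\<lambda>q. if q = i then 1 else 0) - g (\<lambda>_. 0)) * x i 0)"
    proof (rule convex_imp_affine)
      show "g y = g z" if "\<And>i. i < n \<Longrightarrow> y i = z i" for y z
        unfolding g_def emb_def by (intro arg_cong[of _ _ "\<lambda>w. \<beta> 1 w j 0"] restrict_ext) (simp add: that)
      show "g (\<lambda>i. \<Sum>p<k. t p * y p i) = (\<Sum>p<k. t p * g (y p))"
        if "\<And>p. p < k \<Longrightarrow> 0 \<le> t p" "(\<Sum>p<k. t p) = 1"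
          "\<And>p i. p < k \<Longrightarrow> i < n \<Longrightarrow> 0 \<le> y p i" for k :: nat and t y
        by (rule conv) (use that in auto)
    qed (use grid_nonneg[OF x] in auto)
    ultimately show ?thesis by (simp add: g_def)
  qed
  then show ?thesis by (rule that)
qed

section \<open>Functional distributions and families of functions\<close>

text \<open>
  The powers of the carrier of the commutant's algebra, which itself is \<open>\<real>\<^sub>+\<^sup>1\<close>.
\<close>

abbreviation point_power :: "nat \<Rightarrow> (nat \<Rightarrow> nat \<Rightarrow> real) cspace" where
  "point_power n \<equiv> cpower (cpower cRplus 1) n"

lemma carrier_space_Rplus_alg: "carrier_space Rplus_alg = cpower cRplus 1"
  by (simp only: Rplus_alg_def calg.simps)

lemma functional_distributions_iff:
  "\<alpha> \<in> functional_distributions mat_aff Rplus_alg (ctop X) \<longleftrightarrow>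
    (\<forall>n. \<alpha> n \<in> cmaps (chom (ctop X) (point_power n)) (point_power n)) \<and>
    (\<forall>n m. \<forall>\<beta>\<in>points (hom affine_maps n m). \<forall>f\<in>cmaps (ctop X) (point_power n).
      \<beta> 1 (\<alpha> n f) = \<alpha> m (\<lambda>v\<in>topspace X. \<beta> 1 (f v)))"
  by (simp add: functional_distributions_def alg_hom_iff alg_cotensor_def commutant_alg_def
      carrier_space_Rplus_alg del: One_nat_def)

lemma cmaps_component:
  assumes "f \<in> cmaps (ctop X) (point_power n)" "i < n" "j < 1"
  shows "(\<lambda>v. f v i j) \<in> nonneg_cont X"
  using assms grid_nonneg unfolding cmaps_ctop_grid_iff nonneg_cont_def
  by (fastforce simp: PiE_iff)

text \<open>
  A family of \<open>n\<close> real functions, bundled into a map to \<open>(\<real>\<^sub>+\<^sup>1)\<^sup>n\<close>.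
\<close>

definition family_map :: "'v topology \<Rightarrow> nat \<Rightarrow> (nat \<Rightarrow> 'v \<Rightarrow> real) \<Rightarrow> 'v \<Rightarrow> nat \<Rightarrow> nat \<Rightarrow> real" where
  "family_map X n u = (\<lambda>v\<in>topspace X. \<lambda>i\<in>{..<n}. \<lambda>j\<in>{..<1}. u i v)"

lemma family_map_grid:
  assumes "\<And>i. i < n \<Longrightarrow> u i \<in> nonneg_cont X" "v \<in> topspace X"
  shows "family_map X n u v \<in> grid 1 n"
  using nonneg_contD(2)[OF assms(1) assms(2)] assms(2)
  by (auto simp: family_map_def simp del: One_nat_def intro!: restrict_in_grid)

lemma family_map_in:
  assumes "\<And>i. i < n \<Longrightarrow> u i \<in> nonneg_cont X"
  shows "family_map X n u \<in> cmaps (ctop X) (point_power n)"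
  unfolding cmaps_ctop_grid_iff
proof (intro conjI allI impI)
  show "family_map X n u \<in> topspace X \<rightarrow>\<^sub>E grid 1 n"
    using family_map_grid[of n u X] assms by (auto simp: family_map_def simp del: One_nat_def)
  fix i j :: nat assume ij: "i < n" "j < 1"
  show "continuous_map X euclideanreal (\<lambda>v. family_map X n u v i j)"
    by (rule continuous_map_eq[OF nonneg_contD(1)[OF assms[OF ij(1)]]]) (use ij in \<open>simp add: family_map_def\<close>)
qed

lemma family_map_components:
  assumes f: "f \<in> cmaps (ctop X) (point_power n)"
  shows "family_map X n (\<lambda>i v. f v i 0) = f" and "i < n \<Longrightarrow> (\<lambda>v. f v i 0) \<in> nonneg_cont X"
proof -
  show comp: "(\<lambda>v. f v i 0) \<in> nonneg_cont X" if "i < n" for i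
    using f that by (rule cmaps_component) simp
  show "family_map X n (\<lambda>i v. f v i 0) = f"
  proof (rule extensionalityI)
    show "family_map X n (\<lambda>i v. f v i 0) \<in> extensional (topspace X)"
      by (simp add: family_map_def)
    show "f \<in> extensional (topspace X)"
      using cmapsD(2)[OF f] by simp
    fix v assume v: "v \<in> topspace X"
    show "family_map X n (\<lambda>i v. f v i 0) v = f v"
    proof (rule grid_ext)
      show "family_map X n (\<lambda>i v. f v i 0) v \<in> grid 1 n"
        using comp v by (rule family_map_grid)
      show "f v \<in> grid 1 n"
        using cmapsD(1)[OF f] v unfolding points_grid by simp
    qed (use v in \<open>simp add: family_map_def\<close>)
  qed
qed

section \<open>Integration against a compactly supported Radon probability\<close>

locale compact_radon_probability = prob_space M for M :: "'v measure" +
  fixes X :: "'v topology"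
  assumes Hausdorff_X: "Hausdorff_space X"
    and radon: "radon_measure X M"
    and compact_support: "compactin X (measure_support X M)"

lemma compact_radon_probabilityI:
  assumes "Hausdorff_space X" "M \<in> compact_radon_probabilities X"
  shows "compact_radon_probability M X"
  using assms unfolding compact_radon_probabilities_def
  by (auto simp: compact_radon_probability_def compact_radon_probability_axioms_def)

context compact_radon_probability
begin

lemma space_M: "space M = topspace X"
  and sets_M: "sets M = sigma_sets (topspace X) {U. openin X U}"
  and inner_regular: "B \<in> sets M \<Longrightarrow> emeasure M B = (SUP C\<in>{C. compactin X C \<and> C \<subseteq> B}. emeasure M C)"
  using radon by (auto simp: radon_measure_def)

lemma open_in_sets: "openin X U \<Longrightarrow> U \<in> sets M"
  unfolding sets_M by (intro sigma_sets.Basic CollectI)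

lemma closed_in_sets: "closedin X C \<Longrightarrow> C \<in> sets M"
  using sets.compl_sets[OF open_in_sets, of "topspace X - C"] closedin_subset
  by (fastforce simp: space_M double_diff closedin_def)

lemma compact_in_sets: "compactin X C \<Longrightarrow> C \<in> sets M"
  by (intro closed_in_sets compactin_imp_closedin Hausdorff_X)

lemma borel_measurable_nonneg_cont: "u \<in> nonneg_cont X \<Longrightarrow> u \<in> borel_measurable M"
  by (rule borel_measurable_continuous_map[OF space_M sets_M nonneg_contD(1)])

text \<open>
  For a general measure the open null sets can have a union of positive measure. Inner regularity
  prevents this: a compact subset of the union is covered by finitely many of them.
\<close>

lemma emeasure_Compl_support: "emeasure M (topspace X - measure_support X M) = 0"
proof -
  let ?N = "topspace X - measure_support X M"
  have "?N \<in> sets M"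
    using closedin_measure_support by (intro open_in_sets) blast
  moreover have "emeasure M C = 0" if C: "compactin X C" "C \<subseteq> ?N" for C
  proof -
    have "\<exists>U. openin X U \<and> x \<in> U \<and> emeasure M U = 0" if "x \<in> C" for x
    proof -
      have "x \<in> topspace X" "x \<notin> measure_support X M" using that C(2) by auto
      then show ?thesis by (auto simp: measure_support_def zero_less_iff_neq_zero)
    qed
    then have "C \<subseteq> \<Union>{U. openin X U \<and> emeasure M U = 0}"
      by blast
    then obtain F where F: "finite F" "F \<subseteq> {U. openin X U \<and> emeasure M U = 0}" "C \<subseteq> \<Union>F"
      using C(1) unfolding compactin_def by (metis (no_types, lifting) mem_Collect_eq)
    have "\<Union>F \<in> null_sets M"
      using F(1,2) open_in_sets by (intro null_sets.finite_Union) (auto simp: null_sets_def)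
    then have "C \<in> null_sets M"
      using compact_in_sets[OF C(1)] F(3) by (rule null_sets_subset)
    then show ?thesis by (rule null_setsD1)
  qed
  ultimately have "emeasure M ?N = (SUP C\<in>{C. compactin X C \<and> C \<subseteq> ?N}. 0)"
    by (simp add: inner_regular)
  then show ?thesis
    by (simp add: SUP_constant bot_ennreal split: if_splits)
qed

lemma AE_in_support: "AE x in M. x \<in> measure_support X M"
  using emeasure_Compl_support closedin_measure_support[of X M]
  by (intro AE_I[where N = "topspace X - measure_support X M"]) (auto simp: space_M intro: open_in_sets)

lemma integrable_nonneg_cont:
  assumes u: "u \<in> nonneg_cont X"
  shows "integrable M u"
proof -
  have "compact (u ` measure_support X M)"
    using image_compactin[OF compact_support nonneg_contD(1)[OF u]] by simp
  then obtain b where b: "\<And>x. x \<in> measure_support X M \<Longrightarrow> norm (u x) \<le> b"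
    using compact_imp_bounded bounded_iff by (metis imageI)
  show "integrable M u"
  proof (rule integrable_const_bound[OF _ borel_measurable_nonneg_cont[OF u]])
    show "AE x in M. norm (u x) \<le> b"
      using AE_in_support by eventually_elim (rule b)
  qed
qed

text \<open>
  Continuous convergence is locally uniform, hence uniform on the compact support; the integral only
  depends on the values there.
\<close>

lemma integral_tendsto:
  assumes u: "u \<in> nonneg_cont X"
    and \<phi>: "\<forall>\<^sub>F f in F. \<phi> f \<in> nonneg_cont X"
    and conv: "\<And>x. x \<in> topspace X \<Longrightarrow> ((\<lambda>(f, v). \<phi> f v) \<longlongrightarrow> u x) (F \<times>\<^sub>F nhdsin X x)"
  shows "((\<lambda>f. \<integral>v. \<phi> f v \<partial>M) \<longlongrightarrow> (\<integral>v. u v \<partial>M)) F"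
proof (rule tendstoI)
  fix e :: real assume "0 < e"
  define d where "d = e / 3"
  have d: "0 < d" using \<open>0 < e\<close> by (simp add: d_def)
  let ?S = "measure_support X M"
  have "\<exists>W. openin X W \<and> x \<in> W \<and> (\<forall>\<^sub>F f in F. \<forall>v\<in>W. \<bar>\<phi> f v - u v\<bar> \<le> 2 * d)" if x: "x \<in> topspace X" for x
  proof -
    have "\<forall>\<^sub>F p in F \<times>\<^sub>F nhdsin X x. dist (case p of (f, v) \<Rightarrow> \<phi> f v) (u x) < d"
      using tendstoD[OF conv[OF x] d] .
    then obtain P Q where P: "eventually P F" and Q: "eventually Q (nhdsin X x)"
      and PQ: "\<And>f v. P f \<Longrightarrow> Q v \<Longrightarrow> dist (\<phi> f v) (u x) < d"
      unfolding eventually_prod_filter by auto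
    from Q x obtain W where W: "openin X W" "x \<in> W" "\<And>v. v \<in> W \<Longrightarrow> Q v"
      by (auto simp: eventually_nhdsin)
    define W' where "W' = W \<inter> {v \<in> topspace X. u v \<in> ball (u x) d}"
    have "openin X W'"
      unfolding W'_def using W(1) nonneg_contD(1)[OF u]
      by (intro openin_Int openin_continuous_map_preimage[where Y = euclideanreal]) auto
    moreover have "x \<in> W'"
      using W(2) x d by (simp add: W'_def)
    moreover have "\<forall>\<^sub>F f in F. \<forall>v\<in>W'. \<bar>\<phi> f v - u v\<bar> \<le> 2 * d"
      using P
    proof eventually_elim
      case (elim f)
      show ?case
      proof
        fix v assume v: "v \<in> W'"
        then have "\<bar>\<phi> f v - u x\<bar> < d" "\<bar>u x - u v\<bar> < d"
          using PQ[OF elim] W(3) by (auto simp: W'_def dist_real_def)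
        then show "\<bar>\<phi> f v - u v\<bar> \<le> 2 * d" by linarith
      qed
    qed
    ultimately show ?thesis by blast
  qed
  note nbhd = this
  define \<W> where "\<W> = {W. openin X W \<and> (\<forall>\<^sub>F f in F. \<forall>v\<in>W. \<bar>\<phi> f v - u v\<bar> \<le> 2 * d)}"
  have "?S \<subseteq> \<Union>\<W>"
    using nbhd compactin_subset_topspace[OF compact_support] unfolding \<W>_def by blast
  moreover have "\<forall>W\<in>\<W>. openin X W"
    by (simp add: \<W>_def)
  ultimately obtain G where G: "finite G" "G \<subseteq> \<W>" "?S \<subseteq> \<Union>G"
    using compact_support unfolding compactin_def by blast
  have "\<forall>\<^sub>F f in F. \<forall>W\<in>G. \<forall>v\<in>W. \<bar>\<phi> f v - u v\<bar> \<le> 2 * d"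
    using G(1,2) by (intro eventually_ball_finite) (auto simp: \<W>_def)
  with \<phi> show "\<forall>\<^sub>F f in F. dist (\<integral>v. \<phi> f v \<partial>M) (\<integral>v. u v \<partial>M) < e"
  proof eventually_elim
    case (elim f)
    note int = integrable_nonneg_cont[OF elim(1)] integrable_nonneg_cont[OF u]
    have "AE v in M. \<bar>\<phi> f v - u v\<bar> \<le> 2 * d"
      using AE_in_support by eventually_elim (use elim(2) G(3) in blast)
    then have "(\<integral>v. \<bar>\<phi> f v - u v\<bar> \<partial>M) \<le> (\<integral>v. 2 * d \<partial>M)"
      using int by (intro integral_mono_AE) auto
    moreover have "\<bar>(\<integral>v. \<phi> f v - u v \<partial>M)\<bar> \<le> (\<integral>v. \<bar>\<phi> f v - u v\<bar> \<partial>M)"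
      by (rule integral_abs_bound)
    ultimately show ?case
      using int d by (simp add: dist_real_def prob_space d_def)
  qed
qed

lemma integration_distribution_eq:
  "integration_distribution X M n = (\<lambda>f\<in>cmaps (ctop X) (point_power n).
    \<lambda>i\<in>{..<n}. \<lambda>j\<in>{..<1}. \<integral>v. f v i j \<partial>M)"
  by (simp add: integration_distribution_def carrier_space_Rplus_alg del: One_nat_def)

lemma integration_distribution_grid:
  assumes "f \<in> cmaps (ctop X) (point_power n)"
  shows "integration_distribution X M n f \<in> grid 1 n"
  using nonneg_contD(2)[OF cmaps_component[OF assms]] assms
  by (auto simp: integration_distribution_eq space_M simp del: One_nat_def
      intro!: restrict_in_grid integral_nonneg_AE AE_I2)

theorem integration_distribution_in:
  "integration_distribution X M \<in> functional_distributions mat_aff Rplus_alg (ctop X)"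
  unfolding functional_distributions_iff
proof (intro conjI allI ballI)
  fix n
  let ?I = "integration_distribution X M n"
  show "?I \<in> cmaps (chom (ctop X) (point_power n)) (point_power n)"
    unfolding cmaps_grid_iff[OF supported_intros(2)] points_simps
  proof (intro conjI allI impI)
    show "?I \<in> cmaps (ctop X) (point_power n) \<rightarrow>\<^sub>E grid 1 n"
      using integration_distribution_grid by (auto simp: integration_distribution_eq simp del: One_nat_def)
    fix F g and i j :: nat
    assume "converges (chom (ctop X) (point_power n)) F g" and ij: "i < n" "j < 1"
    then have g: "g \<in> cmaps (ctop X) (point_power n)"
      and F: "\<forall>\<^sub>F f in F. f \<in> cmaps (ctop X) (point_power n)"
      and conv: "\<And>G x. converges (ctop X) G x \<Longrightarrow>
          converges (point_power n) (filtermap (\<lambda>(f, a). f a) (F \<times>\<^sub>F G)) (g x)"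
      by (auto simp: chom_def filter_on_def le_principal)
    have "((\<lambda>f. \<integral>v. f v i j \<partial>M) \<longlongrightarrow> (\<integral>v. g v i j \<partial>M)) F"
    proof (rule integral_tendsto)
      show "(\<lambda>v. g v i j) \<in> nonneg_cont X"
        by (rule cmaps_component[OF g ij])
      show "\<forall>\<^sub>F f in F. (\<lambda>v. f v i j) \<in> nonneg_cont X"
        using F by eventually_elim (rule cmaps_component[OF _ ij])
      show "((\<lambda>(f, v). f v i j) \<longlongrightarrow> g x i j) (F \<times>\<^sub>F nhdsin X x)" if "x \<in> topspace X" for x
        using conv[OF converges_nhdsin[OF that]] ij unfolding converges_grid by (simp add: case_prod_beta')
    qed
    moreover have "\<forall>\<^sub>F f in F. (\<integral>v. f v i j \<partial>M) = ?I f i j"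
      using F by eventually_elim (use ij in \<open>simp add: integration_distribution_eq\<close>)
    moreover have "?I g i j = (\<integral>v. g v i j \<partial>M)"
      using g ij by (simp add: integration_distribution_eq)
    ultimately show "((\<lambda>f. ?I f i j) \<longlongrightarrow> ?I g i j) F"
      using Lim_transform_eventually by simp
  qed
next
  fix n m \<beta> f
  assume \<beta>: "\<beta> \<in> points (hom affine_maps n m)" and f: "f \<in> cmaps (ctop X) (point_power n)"
  have \<beta>1: "\<beta> 1 \<in> cmaps (point_power n) (point_power m)"
    using \<beta> unfolding affine_maps_hom_iff by blast
  have \<beta>1_grid: "\<beta> 1 y \<in> grid 1 m" if "y \<in> grid 1 n" for y
    using cmapsD(1)[OF \<beta>1] that unfolding points_grid .
  define g where "g = (\<lambda>v\<in>topspace X. \<beta> 1 (f v))"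
  have f_grid: "f v \<in> grid 1 n" if "v \<in> topspace X" for v
    using cmapsD(1)[OF f] that by (simp only: points_simps(1) points_grid)
  have g: "g \<in> cmaps (ctop X) (point_power m)"
    unfolding cmaps_def
  proof (intro CollectI conjI allI impI)
    show "g \<in> points (ctop X) \<rightarrow>\<^sub>E points (point_power m)"
      unfolding points_grid points_simps(1) g_def using \<beta>1_grid f_grid by auto
    fix F x assume c: "converges (ctop X) F x"
    then have x: "x \<in> topspace X" and F: "\<forall>\<^sub>F v in F. v \<in> topspace X"
      by (auto simp: ctop_def filter_on_def le_principal)
    have "filtermap g F = filtermap (\<beta> 1) (filtermap f F)"
      unfolding filtermap_filtermap filter_eq_iff eventually_filtermap
      using F by (intro allI eventually_subst) (auto elim!: eventually_mono simp: g_def)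
    then show "converges (point_power m) (filtermap g F) (g x)"
      using cmapsD(3)[OF \<beta>1 cmapsD(3)[OF f c]] x by (simp add: g_def)
  qed
  show "\<beta> 1 (integration_distribution X M n f) = integration_distribution X M m g"
  proof (rule grid_ext)
    show "\<beta> 1 (integration_distribution X M n f) \<in> grid 1 m"
      by (intro \<beta>1_grid integration_distribution_grid f)
    show "integration_distribution X M m g \<in> grid 1 m"
      by (rule integration_distribution_grid[OF g])
    fix j l :: nat assume j: "j < m" and l: "l < 1"
    obtain c a where ca: "\<And>x. x \<in> grid 1 n \<Longrightarrow> \<beta> 1 x j 0 = c + (\<Sum>i<n. a i * x i 0)"
      using affine_maps_affine[OF \<beta> j] by blast
    have int: "integrable M (\<lambda>v. f v i 0)" if "i < n" for i
      using cmaps_component[OF f that] by (intro integrable_nonneg_cont) simp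
    have "integration_distribution X M m g j l = (\<integral>v. g v j 0 \<partial>M)"
      using g j l by (simp add: integration_distribution_eq)
    also have "\<dots> = (\<integral>v. c + (\<Sum>i<n. a i * f v i 0) \<partial>M)"
      by (intro Bochner_Integration.integral_cong) (simp_all add: space_M g_def ca f_grid del: One_nat_def)
    also have "\<dots> = c + (\<Sum>i<n. a i * (\<integral>v. f v i 0 \<partial>M))"
    proof -
      have "integrable M (\<lambda>v. \<Sum>i<n. a i * f v i 0)"
        using int by (intro Bochner_Integration.integrable_sum) simp
      moreover have "(\<integral>v. (\<Sum>i<n. a i * f v i 0) \<partial>M) = (\<Sum>i<n. a i * (\<integral>v. f v i 0 \<partial>M))"
        using int by (subst Bochner_Integration.integral_sum) simp_all
      ultimately show ?thesis
        by (simp add: prob_space)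
    qed
    also have "\<dots> = c + (\<Sum>i<n. a i * integration_distribution X M n f i 0)"
      using f by (simp add: integration_distribution_eq)
    also have "\<dots> = \<beta> 1 (integration_distribution X M n f) j l"
      using l ca[OF integration_distribution_grid[OF f]] by simp
    finally show "\<beta> 1 (integration_distribution X M n f) j l = integration_distribution X M m g j l" ..
  qed
qed

text \<open>
  Outer regularity on compact sets follows from inner regularity of the complement, since the measure
  is finite.
\<close>

lemma open_close_to_compact:
  assumes C: "compactin X C" and e: "0 < e"
  obtains U where "openin X U" "C \<subseteq> U" "measure M U \<le> measure M C + e"
proof -
  have closed: "closedin X C"
    using C by (rule compactin_imp_closedin[OF Hausdorff_X])
  have B: "topspace X - C \<in> sets M"
    using closed by (intro open_in_sets) blast
  have "\<exists>D\<in>{D. compactin X D \<and> D \<subseteq> topspace X - C}. emeasure M (topspace X - C) < emeasure M D + ennreal e"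
    using e by (intro SUP_approx_ennreal[OF _ _ inner_regular[OF B]]) (auto intro: exI[of _ "{}"])
  then obtain D where D: "compactin X D" "D \<subseteq> topspace X - C"
    and lt: "emeasure M (topspace X - C) < emeasure M D + ennreal e" by auto
  have "measure M (topspace X - C) < measure M D + e"
    using lt e by (simp add: emeasure_eq_measure ennreal_less_iff ennreal_plus[symmetric] del: ennreal_plus)
  then have "measure M (topspace X - D) \<le> measure M C + e"
    using prob_compl[OF compact_in_sets[OF C]] prob_compl[OF compact_in_sets[OF D(1)]] by (simp add: space_M)
  moreover have "openin X (topspace X - D)"
    using compactin_imp_closedin[OF Hausdorff_X D(1)] by blast
  ultimately show ?thesis
    using D(2) compactin_subset_topspace[OF C] by (intro that[of "topspace X - D"]) auto
qed

end

text \<open>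
  Squeezing a bump between a compact set and an open set of almost the same measure determines the
  measure of compact sets, and these determine everything by inner regularity.
\<close>

lemma compact_radon_probability_eqI:
  assumes M: "compact_radon_probability M X" and N: "compact_radon_probability N X"
    and LC: "locally_compact_space X"
    and eq: "\<And>u. u \<in> nonneg_cont X \<Longrightarrow> (\<integral>x. u x \<partial>M) = (\<integral>x. u x \<partial>N)"
  shows "M = N"
proof -
  have le: "measure M' C \<le> measure N' C"
    if M': "compact_radon_probability M' X" and N': "compact_radon_probability N' X" and C: "compactin X C"
    and eq: "\<And>u. u \<in> nonneg_cont X \<Longrightarrow> (\<integral>x. u x \<partial>M') = (\<integral>x. u x \<partial>N')" for M' N' C
  proof (rule field_le_epsilon)
    interpret M: compact_radon_probability M' X by fact
    interpret N: compact_radon_probability N' X by fact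
    fix e :: real assume "0 < e"
    obtain U where U: "openin X U" "C \<subseteq> U" "measure N' U \<le> measure N' C + e"
      using N.open_close_to_compact[OF C \<open>0 < e\<close>] .
    obtain u where u: "u \<in> bumps X U" "\<And>x. x \<in> C \<Longrightarrow> u x = 1"
      using bump_exists[OF LC M.Hausdorff_X C U(1,2)] by blast
    have C': "C \<in> sets M'" and U': "U \<in> sets N'"
      using C U(1) by (auto intro: M.compact_in_sets N.open_in_sets)
    have "measure M' C = (\<integral>x. indicat_real C x \<partial>M')"
      using C' by simp
    also have "\<dots> \<le> (\<integral>x. u x \<partial>M')"
      using u(2) bumpsD(2)[OF u(1)] C'
      by (intro integral_mono M.integrable_nonneg_cont[OF bumpsD(1)[OF u(1)]] integrable_real_indicator)
         (auto simp: M.space_M less_top[symmetric] split: split_indicator)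
    also have "\<dots> = (\<integral>x. u x \<partial>N')"
      by (rule eq[OF bumpsD(1)[OF u(1)]])
    also have "\<dots> \<le> (\<integral>x. indicat_real U x \<partial>N')"
      using bumpsD(3,4)[OF u(1)] U'
      by (intro integral_mono N.integrable_nonneg_cont[OF bumpsD(1)[OF u(1)]] integrable_real_indicator)
         (auto simp: N.space_M less_top[symmetric] split: split_indicator)
    also have "\<dots> = measure N' U"
      using U' by simp
    finally show "measure M' C \<le> measure N' C + e"
      using U(3) by linarith
  qed
  interpret M: compact_radon_probability M X by fact
  interpret N: compact_radon_probability N X by fact
  have "measure M C = measure N C" if "compactin X C" for C
    using le[OF M N that eq] le[OF N M that eq[symmetric]] by simp
  then have compact: "emeasure M C = emeasure N C" if "compactin X C" for C
    using that by (simp add: M.emeasure_eq_measure N.emeasure_eq_measure)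
  show ?thesis
  proof (rule measure_eqI)
    show sets: "sets M = sets N" by (simp add: M.sets_M N.sets_M)
    show "emeasure M B = emeasure N B" if "B \<in> sets M" for B
      using that by (simp add: M.inner_regular N.inner_regular sets[symmetric] compact cong: SUP_cong_simp)
  qed
qed

lemma (in compact_radon_probability) integration_distribution_family_map:
  assumes "u \<in> nonneg_cont X"
  shows "integration_distribution X M 1 (family_map X 1 (\<lambda>_. u)) 0 0 = (\<integral>v. u v \<partial>M)"
proof -
  have "family_map X 1 (\<lambda>_. u) \<in> cmaps (ctop X) (point_power 1)"
    using assms by (intro family_map_in)
  then have "integration_distribution X M 1 (family_map X 1 (\<lambda>_. u)) 0 0 =
      (\<integral>v. family_map X 1 (\<lambda>_. u) v 0 0 \<partial>M)"
    by (simp add: integration_distribution_eq)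
  also have "\<dots> = (\<integral>v. u v \<partial>M)"
    by (intro Bochner_Integration.integral_cong) (simp_all add: family_map_def space_M)
  finally show ?thesis .
qed

section \<open>Every functional distribution is an integral\<close>

locale functional_distribution =
  fixes X :: "'v topology" and \<alpha> :: "nat \<Rightarrow> ('v \<Rightarrow> nat \<Rightarrow> nat \<Rightarrow> real) \<Rightarrow> nat \<Rightarrow> nat \<Rightarrow> real"
  assumes locally_compact_X: "locally_compact_space X"
    and Hausdorff_X: "Hausdorff_space X"
    and distribution: "\<alpha> \<in> functional_distributions mat_aff Rplus_alg (ctop X)"
begin

lemma continuous_\<alpha>: "\<alpha> n \<in> cmaps (chom (ctop X) (point_power n)) (point_power n)"
  using distribution unfolding functional_distributions_iff by blast

lemma \<alpha>_grid: "f \<in> cmaps (ctop X) (point_power n) \<Longrightarrow> \<alpha> n f \<in> grid 1 n"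
  using cmapsD(1)[OF continuous_\<alpha>] unfolding points_grid by simp

lemma natural:
  "\<beta> \<in> points (hom affine_maps n m) \<Longrightarrow> f \<in> cmaps (ctop X) (point_power n) \<Longrightarrow>
    \<beta> 1 (\<alpha> n f) = \<alpha> m (\<lambda>v\<in>topspace X. \<beta> 1 (f v))"
  using distribution unfolding functional_distributions_iff by blast

definition mean :: "('v \<Rightarrow> real) \<Rightarrow> real" where
  "mean u = \<alpha> 1 (family_map X 1 (\<lambda>_. u)) 0 0"

text \<open>
  Naturality with respect to the operation \<open>affine_op n c a\<close>.
\<close>

lemma mean_affine_components:
  assumes u: "\<And>i. i < n \<Longrightarrow> u i \<in> nonneg_cont X" and ca: "0 \<le> c" "\<And>i. 0 \<le> a i"
  shows "mean (\<lambda>v. c + (\<Sum>i<n. a i * u i v)) = c + (\<Sum>i<n. a i * \<alpha> n (family_map X n u) i 0)"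
proof -
  let ?\<beta> = "affine_op n c a"
  note f = family_map_in[of n u X, OF u]
  have "(\<lambda>v\<in>topspace X. ?\<beta> 1 (family_map X n u v)) = family_map X 1 (\<lambda>_ v. c + (\<Sum>i<n. a i * u i v))"
    unfolding family_map_def[of X 1]
  proof (intro restrict_ext)
    fix v assume v: "v \<in> topspace X"
    have "?\<beta> 1 (family_map X n u v) = (\<lambda>i\<in>{..<1}. \<lambda>p\<in>{..<1}. c + (\<Sum>l<n. a l * family_map X n u v l p))"
      using family_map_grid[of n u X, OF u v] by (simp add: affine_op_def del: One_nat_def)
    also have "\<dots> = (\<lambda>i\<in>{..<1}. \<lambda>p\<in>{..<1}. c + (\<Sum>l<n. a l * u l v))"
      by (intro restrict_ext) (simp add: family_map_def v)
    finally show "?\<beta> 1 (family_map X n u v) = (\<lambda>i\<in>{..<1}. \<lambda>p\<in>{..<1}. c + (\<Sum>l<n. a l * u l v))" .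
  qed
  then have "mean (\<lambda>v. c + (\<Sum>i<n. a i * u i v)) = \<alpha> 1 (\<lambda>v\<in>topspace X. ?\<beta> 1 (family_map X n u v)) 0 0"
    by (simp add: mean_def)
  also have "\<dots> = ?\<beta> 1 (\<alpha> n (family_map X n u)) 0 0"
    by (simp only: natural[OF affine_op_in[OF ca] f])
  also have "\<dots> = c + (\<Sum>i<n. a i * \<alpha> n (family_map X n u) i 0)"
    using \<alpha>_grid[OF f] by (simp add: affine_op_def)
  finally show ?thesis .
qed

text \<open>
  Naturality with respect to the projections, which are affine operations; so \<open>\<alpha>\<close> is determined by
  \<open>mean\<close>.
\<close>

lemma \<alpha>_component:
  assumes u: "\<And>i. i < n \<Longrightarrow> u i \<in> nonneg_cont X" and i: "i < n"
  shows "\<alpha> n (family_map X n u) i 0 = mean (u i)"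
proof -
  have "(\<Sum>l<n. (if l = i then 1 else 0) * t l) = t i" for t :: "nat \<Rightarrow> real"
    using i by (simp add: if_distrib[of "\<lambda>z. z * _"] cong: if_cong)
  then show ?thesis
    using mean_affine_components[of n u 0 "\<lambda>l. if l = i then 1 else 0", OF u] by simp
qed

lemma mean_affine:
  fixes n :: nat
  assumes u: "\<And>i. i < n \<Longrightarrow> u i \<in> nonneg_cont X" and ca: "0 \<le> c" "\<And>i. 0 \<le> a i"
  shows "mean (\<lambda>v. c + (\<Sum>i<n. a i * u i v)) = c + (\<Sum>i<n. a i * mean (u i))"
  using mean_affine_components[of n u c a, OF u ca] by (simp add: \<alpha>_component[of n u, OF u])

lemma mean_nonneg: "u \<in> nonneg_cont X \<Longrightarrow> 0 \<le> mean u"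
  unfolding mean_def by (intro grid_nonneg[OF \<alpha>_grid[OF family_map_in]]) auto

lemma mean_const: "0 \<le> c \<Longrightarrow> mean (\<lambda>_. c) = c"
  using mean_affine[of 0 "\<lambda>_ _. 0" c "\<lambda>_. 0"] by simp

lemma mean_scale: "0 \<le> c \<Longrightarrow> u \<in> nonneg_cont X \<Longrightarrow> mean (\<lambda>v. c * u v) = c * mean u"
  using mean_affine[of 1 "\<lambda>_. u" 0 "\<lambda>_. c"] by simp

lemma mean_add:
  assumes "u \<in> nonneg_cont X" "w \<in> nonneg_cont X"
  shows "mean (\<lambda>v. u v + w v) = mean u + mean w"
  using mean_affine[of 2 "\<lambda>i. if i = 0 then u else w" 0 "\<lambda>_. 1"] assms by (simp add: numeral_2_eq_2)

definition vanishing_filter :: "('v \<Rightarrow> nat \<Rightarrow> nat \<Rightarrow> real) filter" where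
  "vanishing_filter = (INF C\<in>Collect (compactin X).
    principal {f \<in> cmaps (ctop X) (point_power 1). \<forall>v\<in>C. f v 0 0 = 0})"

lemma eventually_vanishing_filter:
  "eventually P vanishing_filter \<longleftrightarrow>
    (\<exists>C. compactin X C \<and> (\<forall>f\<in>cmaps (ctop X) (point_power 1). (\<forall>v\<in>C. f v 0 0 = 0) \<longrightarrow> P f))"
  unfolding vanishing_filter_def
proof (subst eventually_INF_base, goal_cases)
  case 1
  show ?case using compactin_empty by blast
next
  case (2 C D)
  then have "compactin X (C \<union> D)" by (simp add: compactin_Un)
  then show ?case by (intro bexI[of _ "C \<union> D"]) auto
qed (auto simp: eventually_principal)

lemma zero_cmap: "family_map X n (\<lambda>_ _. 0) \<in> cmaps (ctop X) (point_power n)"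
  by (intro family_map_in nonneg_cont_const) simp

text \<open>
  Any filter \<open>G\<close> converging to \<open>x\<close> contains a compact neighbourhood of \<open>x\<close>, and the functions that
  vanish on this neighbourhood form a set of the filter.
\<close>

lemma vanishing_filter_converges:
  "converges (chom (ctop X) (point_power 1)) vanishing_filter (family_map X 1 (\<lambda>_ _. 0))"
proof -
  let ?z = "family_map X 1 (\<lambda>_ _. 0)"
  let ?D = "cmaps (ctop X) (point_power 1)"
  have D: "\<forall>\<^sub>F f in vanishing_filter. f \<in> ?D"
    unfolding eventually_vanishing_filter using compactin_empty by blast
  have bot: "vanishing_filter \<noteq> bot"
  proof
    assume "vanishing_filter = bot"
    then have "eventually (\<lambda>_. False) vanishing_filter" by simp
    then obtain C where C: "compactin X C" "\<And>f. f \<in> ?D \<Longrightarrow> \<exists>v\<in>C. f v 0 0 \<noteq> 0"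
      unfolding eventually_vanishing_filter by blast
    obtain v where "v \<in> C" "?z v 0 0 \<noteq> 0" using C(2)[OF zero_cmap] by blast
    then show False
      using compactin_subset_topspace[OF C(1)] by (auto simp: family_map_def)
  qed
  have "converges (point_power 1) (filtermap (\<lambda>(f, a). f a) (vanishing_filter \<times>\<^sub>F G)) (?z x)"
    if G: "converges (ctop X) G x" for G x
  proof -
    have x: "x \<in> topspace X" and G: "G \<noteq> bot" "\<forall>\<^sub>F v in G. v \<in> topspace X" "G \<le> nhdsin X x"
      using G by (auto simp: ctop_def filter_on_def le_principal)
    obtain W C where W: "openin X W" "compactin X C" "x \<in> W" "W \<subseteq> C"
      using locally_compact_X x unfolding locally_compact_space_def by blast
    have WG: "\<forall>\<^sub>F v in G. v \<in> W"
      using G(3) W x by (intro filter_leD[OF G(3)]) (auto simp: eventually_nhdsin)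
    have van: "\<forall>\<^sub>F f in vanishing_filter. \<forall>v\<in>C. f v 0 0 = 0"
      unfolding eventually_vanishing_filter using W(2) by blast
    have "?z x \<in> grid 1 1"
      using x by (intro family_map_grid nonneg_cont_const) auto
    moreover have "vanishing_filter \<times>\<^sub>F G \<noteq> bot"
      using bot G(1) by (simp add: prod_filter_eq_bot)
    moreover have "\<forall>\<^sub>F p in vanishing_filter \<times>\<^sub>F G. (case p of (f, a) \<Rightarrow> f a) \<in> grid 1 1"
      unfolding eventually_prod_filter
    proof (intro exI conjI allI impI)
      fix f v assume "f \<in> ?D" "v \<in> topspace X"
      then have "f v \<in> grid 1 1"
        using cmapsD(1)[of f "ctop X" "point_power 1" v] unfolding points_grid points_simps(1) by blast
      then show "(case (f, v) of (f, a) \<Rightarrow> f a) \<in> grid 1 1" by simp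
    qed (use D G in auto)
    moreover have "((\<lambda>p. (case p of (f, a) \<Rightarrow> f a) i j) \<longlongrightarrow> ?z x i j) (vanishing_filter \<times>\<^sub>F G)"
      if "i < 1" "j < 1" for i j
    proof (rule tendsto_eventually)
      show "\<forall>\<^sub>F p in vanishing_filter \<times>\<^sub>F G. (case p of (f, a) \<Rightarrow> f a) i j = ?z x i j"
        unfolding eventually_prod_filter
      proof (intro exI conjI allI impI)
        fix f :: "'v \<Rightarrow> nat \<Rightarrow> nat \<Rightarrow> real" and v
        assume "\<forall>v\<in>C. f v 0 0 = 0" "v \<in> W"
        then show "(case (f, v) of (f, a) \<Rightarrow> f a) i j = ?z x i j"
          using W(4) x that by (auto simp: family_map_def)
      qed (use van WG in auto)
    qed
    ultimately show ?thesis
      unfolding converges_grid by blast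
  qed
  then show ?thesis
    using zero_cmap bot D by (simp add: chom_def filter_on_def le_principal del: One_nat_def)
qed

text \<open>
  Continuity along \<open>vanishing_filter\<close> gives a compact set \<open>K\<close> such that \<open>mean u < 1\<close> whenever \<open>u\<close>
  vanishes on \<open>K\<close>. If \<open>mean u\<close> were positive, then \<open>u\<close> divided by it would violate this.
\<close>

lemma compactly_supported:
  obtains K where "compactin X K"
    "\<And>u. u \<in> nonneg_cont X \<Longrightarrow> (\<And>x. x \<in> K \<Longrightarrow> u x = 0) \<Longrightarrow> mean u = 0"
proof -
  have "converges (point_power 1) (filtermap (\<alpha> 1) vanishing_filter) (\<alpha> 1 (family_map X 1 (\<lambda>_ _. 0)))"
    by (rule cmapsD(3)[OF continuous_\<alpha> vanishing_filter_converges])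
  then have "((\<lambda>f. \<alpha> 1 f 0 0) \<longlongrightarrow> mean (\<lambda>_. 0)) vanishing_filter"
    unfolding converges_grid mean_def by simp
  then have "\<forall>\<^sub>F f in vanishing_filter. \<alpha> 1 f 0 0 < 1"
    by (rule order_tendstoD(2)) (simp add: mean_const)
  then obtain K where K: "compactin X K"
    and lt: "\<And>f. f \<in> cmaps (ctop X) (point_power 1) \<Longrightarrow> (\<And>v. v \<in> K \<Longrightarrow> f v 0 0 = 0) \<Longrightarrow> \<alpha> 1 f 0 0 < 1"
    unfolding eventually_vanishing_filter by blast
  have mean_lt: "mean u < 1" if "u \<in> nonneg_cont X" "\<And>x. x \<in> K \<Longrightarrow> u x = 0" for u
    unfolding mean_def using that compactin_subset_topspace[OF K]
    by (intro lt family_map_in) (auto simp: family_map_def)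
  have "mean u = 0" if u: "u \<in> nonneg_cont X" "\<And>x. x \<in> K \<Longrightarrow> u x = 0" for u
  proof (rule ccontr)
    assume "mean u \<noteq> 0"
    with mean_nonneg[OF u(1)] have pos: "0 < mean u" by simp
    have "mean (\<lambda>x. (1 / mean u) * u x) < 1"
      using pos u by (intro mean_lt nonneg_cont_scale) auto
    then show False
      using pos u(1) mean_scale[of "1 / mean u" u] by simp
  qed
  with K show ?thesis by (rule that)
qed

lemma represented:
  obtains M where "M \<in> compact_radon_probabilities X" "integration_distribution X M = \<alpha>"
proof -
  obtain K where K: "compactin X K"
    "\<And>u. u \<in> nonneg_cont X \<Longrightarrow> (\<And>x. x \<in> K \<Longrightarrow> u x = 0) \<Longrightarrow> mean u = 0"
    by (rule compactly_supported) blast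
  interpret R: compactly_supported_mean X K mean
    by unfold_locales
      (use K locally_compact_X Hausdorff_X mean_nonneg mean_add mean_scale mean_const in auto)
  interpret M: compact_radon_probability R.riesz_measure X
    by (rule compact_radon_probabilityI[OF Hausdorff_X R.riesz_measure_compact_radon_probability])
  have "integration_distribution X R.riesz_measure n = \<alpha> n" for n
  proof (rule extensionalityI)
    let ?I = "integration_distribution X R.riesz_measure n"
    show "?I \<in> extensional (cmaps (ctop X) (point_power n))"
      by (simp add: M.integration_distribution_eq)
    show "\<alpha> n \<in> extensional (cmaps (ctop X) (point_power n))"
      using cmapsD(2)[OF continuous_\<alpha>] by simp
    fix f assume f: "f \<in> cmaps (ctop X) (point_power n)"
    note comp = family_map_components[OF f]
    show "?I f = \<alpha> n f"
    proof (rule grid_ext[OF M.integration_distribution_grid[OF f] \<alpha>_grid[OF f]])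
      fix i j :: nat assume ij: "i < n" "j < 1"
      have "\<alpha> n f i 0 = mean (\<lambda>v. f v i 0)"
        using \<alpha>_component[of n "\<lambda>i v. f v i 0" i, OF comp(2) ij(1)] by (simp add: comp(1))
      also have "\<dots> = ?I f i 0"
        using f ij by (simp add: M.integration_distribution_eq R.L_eq_integral[OF comp(2)])
      finally show "?I f i j = \<alpha> n f i j"
        using ij by simp
    qed
  qed
  then show ?thesis
    using R.riesz_measure_compact_radon_probability by (intro that[of R.riesz_measure]) auto
qed

end

theorem theorem10p10:
  fixes V :: "'v topology"
  assumes "locally_compact_space V" and "Hausdorff_space V"
  shows "bij_betw (integration_distribution V)
    (compact_radon_probabilities V)
    (functional_distributions mat_aff Rplus_alg (ctop V))"
proof (rule bij_betw_imageI)
  let ?R = "compact_radon_probabilities V" and ?D = "functional_distributions mat_aff Rplus_alg (ctop V)"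
  note R = compact_radon_probabilityI[OF assms(2)]
  show "inj_on (integration_distribution V) ?R"
  proof (rule inj_onI)
    fix M N assume MN: "M \<in> ?R" "N \<in> ?R"
      and eq: "integration_distribution V M = integration_distribution V N"
    interpret M: compact_radon_probability M V by (rule R[OF MN(1)])
    interpret N: compact_radon_probability N V by (rule R[OF MN(2)])
    show "M = N"
    proof (rule compact_radon_probability_eqI[OF R[OF MN(1)] R[OF MN(2)] assms(1)])
      show "(\<integral>x. u x \<partial>M) = (\<integral>x. u x \<partial>N)" if "u \<in> nonneg_cont V" for u
        using M.integration_distribution_family_map[OF that] N.integration_distribution_family_map[OF that]
        by (simp add: eq)
    qed
  qed
  show "integration_distribution V ` ?R = ?D"
  proof (intro equalityI subsetI)
    fix \<alpha> assume "\<alpha> \<in> integration_distribution V ` ?R"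
    then show "\<alpha> \<in> ?D"
      using compact_radon_probability.integration_distribution_in R by blast
  next
    fix \<alpha> assume "\<alpha> \<in> ?D"
    then interpret functional_distribution V \<alpha>
      using assms by unfold_locales
    show "\<alpha> \<in> integration_distribution V ` ?R"
      by (rule represented) blast
  qed
qed

end
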